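(* Let $\vartheta\in C^\infty_0(\ell^2)$, let $f\in \mathrm{Lip}(\ell^2)$, and for each $\varepsilon>0$ set $$f_\varepsilon(\mathbf z)=\int_{\ell^2} f(\mathbf z-\varepsilon\zeta)\,\vartheta(\zeta)\,dP(\zeta),\qquad \mathbf z\in\ell^2 .$$ Then $f_\varepsilon\in C^\infty_{F^\infty}(\ell^2)$ for every $\varepsilon>0$. Moreover, if $\int_{\ell^2}\vartheta(\zeta)\,dP(\zeta)=1$, then $f_\varepsilon(\mathbf z)\to f(\mathbf z)$ as $\varepsilon\to0^+$ for every $\mathbf z\in\ell^2$.
   Context: $\ell^2$ is the complex Hilbert space of square-summable complex sequences $\mathbf z=(z_j)_{j\ge1}$, $z_j=x_j+\sqrt{-1}\,y_j$ with $x_j,y_j\in\mathbb R$, with its canonical norm $\|\cdot\|$. Measure: a sequence $(a_i)_{i\ge1}$ of positive numbers with $\sum_i a_i<1$ is fixed. Let $\mathcal N=\prod_{i=1}^\infty \frac{1}{2\pi a_i^2}e^{-(x_i^2+y_i^2)/(2a_i^2)}\,dx_i\,dy_i$ be the product Gaussian measure on $\mathbb C^\infty=\prod_{i\ge1}\mathbb C$. Then $\ell^2$ is a Borel subset of $\mathbb C^\infty$ with $\mathcal N(\ell^2)=1$, the Borel sets of $\ell^2$ are exactly the sets $F\cap\ell^2$ with $F$ Borel in $\mathbb C^\infty$, and $P$ is the Borel probability measure on $\ell^2$ given by $P(E)=\mathcal N(F)$ whenever $E=F\cap\ell^2$ with $F$ Borel in $\mathbb C^\infty$. Function spaces on $\ell^2$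 (a subset of $\ell^2$ is called uniformly included in $\ell^2$ exactly when it is bounded): - $\mathrm{Lip}(\ell^2)$: all $f:\ell^2\to\mathbb C$ such that for each bounded $S\subset\ell^2$ there is $C(S)>0$ with $|f(\mathbf z)-f(\mathbf w)|\le C(S)\|\mathbf z-\mathbf w\|$ for all $\mathbf z,\mathbf w\in S$. - Partial derivatives $\partial/\partial x_j$ and $\partial/\partial y_j$ are the usual limits of difference quotients in the $j$-th coordinate along real increments $\tau$ and imaginary increments $\sqrt{-1}\,\tau$ ($\tau\in\mathbb R$). $C^k(\ell^2)$ is the set of $f:\ell^2\to\mathbb C$ such that $f$ and all its partial derivatives (in the variables $x_j,y_j$, $j\ge1$) of order up to $k$ exist and are continuous on $\ell^2$; $C^\infty=\bigcap_k C^k$. - $\partial_j=\frac12(\frac{\partial}{\partial x_j}-\sqrt{-1}\frac{\partial}{\partial y_j})$, $\overline\partial_j=\frac12(\frac{\partial}{\partial x_j}+\sqrt{-1}\frac{\partial}{\partial y_j})$. For finitely supported sequences $\alpha,\beta$ of nonnegative integers, $\partial_\alpha=\prod_j\partial_j^{\alpha_j}$ and $\overline\partial_\beta=\prod_j\overline\partial_j^{\beta_j}$. - $C^1_F(\ell^2)$: all $f\in C^1(\ell^2)$ with $\sup_S\{|f|+\sum_{j\ge1}(|\partial_jf|^2+|\overline\partial_jf|^2)\}<\infty$ for every bounded $S\subset\ell^2$. - $C^\infty_{F^\infty}(\ell^2)$: all $f\in C^\infty(\ell^2)$ such that $\partial_\alpha\overline\partial_\beta f\in C^1_F(\ell^2)$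 for all finitely supported multi-indices $\alpha,\beta$. - $C^\infty_0(\ell^2)$: all $f\in C^\infty(\ell^2)$ whose support $\overline{\{f\ne0\}}$ is bounded and such that $\sup_{\ell^2}|\partial_\alpha\overline\partial_\beta f|<\infty$ for all finitely supported multi-indices $\alpha,\beta$. *)

theory Defs
  imports "HOL-Probability.Probability"
begin

(* Coordinates are indexed by nat starting at 0 instead of 1. *)

typedef ell2 = "{z :: nat \<Rightarrow> complex. summable (\<lambda>j. (cmod (z j))\<^sup>2)}"
  morphisms coord Abs_ell2
  by (rule exI[of _ "\<lambda>_. 0"]) simp

setup_lifting type_definition_ell2

lemma summable_coord: "summable (\<lambda>j. (cmod (coord z j))\<^sup>2)"
  using coord[of z] by simp

lemma ell2_eqI: "(\<And>j. coord z j = coord w j) \<Longrightarrow> z = w"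
  by (metis coord_inject ext)

lemma square_summable_add:
  fixes z w :: "nat \<Rightarrow> complex"
  assumes "summable (\<lambda>j. (cmod (z j))\<^sup>2)" "summable (\<lambda>j. (cmod (w j))\<^sup>2)"
  shows "summable (\<lambda>j. (cmod (z j + w j))\<^sup>2)"
proof (rule summable_comparison_test')
  show "summable (\<lambda>j. 2 * (cmod (z j))\<^sup>2 + 2 * (cmod (w j))\<^sup>2)"
    by (intro summable_add summable_mult assms)
  show "norm ((cmod (z j + w j))\<^sup>2) \<le> 2 * (cmod (z j))\<^sup>2 + 2 * (cmod (w j))\<^sup>2" for j
  proof -
    have "(cmod (z j + w j))\<^sup>2 \<le> (cmod (z j) + cmod (w j))\<^sup>2"
      by (intro power_mono norm_triangle_ineq) simp
    also have "\<dots> \<le> 2 * (cmod (z j))\<^sup>2 + 2 * (cmod (w j))\<^sup>2"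
      using zero_le_power2[of "cmod (z j) - cmod (w j)"]
      by (simp add: power2_sum power2_diff)
    finally show ?thesis by simp
  qed
qed

lemma square_summable_scaleR:
  fixes z :: "nat \<Rightarrow> complex"
  assumes "summable (\<lambda>j. (cmod (z j))\<^sup>2)"
  shows "summable (\<lambda>j. (cmod (r *\<^sub>R z j))\<^sup>2)"
  using summable_mult[OF assms, of "r\<^sup>2"] by (simp add: power_mult_distrib)

lemma summable_coord_inner: "summable (\<lambda>j. coord z j \<bullet> coord w j)"
proof (rule summable_comparison_test')
  show "summable (\<lambda>j. (cmod (coord z j))\<^sup>2 + (cmod (coord w j))\<^sup>2)"
    by (intro summable_add summable_coord)
  show "norm (coord z j \<bullet> coord w j) \<le> (cmod (coord z j))\<^sup>2 + (cmod (coord w j))\<^sup>2" for j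
  proof -
    have "\<bar>coord z j \<bullet> coord w j\<bar> \<le> cmod (coord z j) * cmod (coord w j)"
      by (rule Cauchy_Schwarz_ineq2)
    also have "\<dots> \<le> (cmod (coord z j))\<^sup>2 + (cmod (coord w j))\<^sup>2"
    proof -
      have "0 \<le> cmod (coord z j) * cmod (coord w j)"
        by simp
      then show ?thesis
        using sum_squares_bound[of "cmod (coord z j)" "cmod (coord w j)"] by linarith
    qed
    finally show ?thesis by simp
  qed
qed

(* The real inner product is the real part of the Hermitian one, so the two induce the same norm. *)

instantiation ell2 :: real_inner
begin

lift_definition zero_ell2 :: ell2 is "\<lambda>_. 0"
  by simp

lift_definition plus_ell2 :: "ell2 \<Rightarrow> ell2 \<Rightarrow> ell2" is "\<lambda>z w j. z j + w j"
  by (rule square_summable_add)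

lift_definition scaleR_ell2 :: "real \<Rightarrow> ell2 \<Rightarrow> ell2" is "\<lambda>r z j. r *\<^sub>R z j"
  by (rule square_summable_scaleR)

lift_definition uminus_ell2 :: "ell2 \<Rightarrow> ell2" is "\<lambda>z j. - z j"
  by simp

definition minus_ell2 :: "ell2 \<Rightarrow> ell2 \<Rightarrow> ell2" where
  "minus_ell2 z w = z + - w"

definition inner_ell2 :: "ell2 \<Rightarrow> ell2 \<Rightarrow> real" where
  "inner_ell2 z w = (\<Sum>j. coord z j \<bullet> coord w j)"

definition norm_ell2 :: "ell2 \<Rightarrow> real" where
  "norm_ell2 z = sqrt (\<Sum>j. (cmod (coord z j))\<^sup>2)"

definition dist_ell2 :: "ell2 \<Rightarrow> ell2 \<Rightarrow> real" where
  "dist_ell2 z w = norm (z - w)"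

definition sgn_ell2 :: "ell2 \<Rightarrow> ell2" where
  "sgn_ell2 z = inverse (norm z) *\<^sub>R z"

definition uniformity_ell2 :: "(ell2 \<times> ell2) filter" where
  "uniformity_ell2 = (INF e\<in>{0 <..}. principal {(z, w). dist z w < e})"

definition open_ell2 :: "ell2 set \<Rightarrow> bool" where
  "open_ell2 U \<longleftrightarrow> (\<forall>z\<in>U. \<forall>\<^sub>F (z', w) in uniformity. z' = z \<longrightarrow> w \<in> U)"

instance
proof
  fix x y z :: ell2 and r s :: real
  show "x + y + z = x + (y + z)" "x + y = y + x" "0 + x = x" "- x + x = 0"
    by (transfer; simp add: algebra_simps)+
  show "x - y = x + - y"
    by (simp add: minus_ell2_def)
  show "r *\<^sub>R (x + y) = r *\<^sub>R x + r *\<^sub>R y" "(r + s) *\<^sub>R x = r *\<^sub>R x + s *\<^sub>R x"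
    "r *\<^sub>R s *\<^sub>R x = (r * s) *\<^sub>R x" "1 *\<^sub>R x = x"
    by (transfer; simp add: algebra_simps)+
  show "dist x y = norm (x - y)"
    by (simp add: dist_ell2_def)
  show "sgn x = inverse (norm x) *\<^sub>R x"
    by (simp add: sgn_ell2_def)
  show "uniformity = (INF e\<in>{0 <..}. principal {(z :: ell2, w). dist z w < e})"
    by (simp add: uniformity_ell2_def)
  show "open U \<longleftrightarrow> (\<forall>z\<in>U. \<forall>\<^sub>F (z', w) in uniformity. z' = z \<longrightarrow> w \<in> U)" for U :: "ell2 set"
    by (rule open_ell2_def)
  show "x \<bullet> y = y \<bullet> x"
    by (simp add: inner_ell2_def inner_commute)
  show "(x + y) \<bullet> z = x \<bullet> z + y \<bullet> z"
    by (simp add: inner_ell2_def plus_ell2.rep_eq inner_add_left suminf_add summable_coord_inner)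
  show "r *\<^sub>R x \<bullet> y = r * (x \<bullet> y)"
    by (simp add: inner_ell2_def scaleR_ell2.rep_eq suminf_mult summable_coord_inner)
  show "0 \<le> x \<bullet> x"
    by (simp add: inner_ell2_def suminf_nonneg summable_coord_inner)
  show "x \<bullet> x = 0 \<longleftrightarrow> x = 0"
    using suminf_eq_zero_iff[OF summable_coord_inner, of x x]
    by (auto simp: inner_ell2_def zero_ell2.rep_eq intro!: ell2_eqI)
  show "norm x = sqrt (x \<bullet> x)"
    by (simp add: norm_ell2_def inner_ell2_def power2_norm_eq_inner)
qed

end

text \<open>The vector with entry \<open>c\<close> in position \<open>j\<close> and zeros elsewhere.\<close>

lift_definition single_coord :: "nat \<Rightarrow> complex \<Rightarrow> ell2" is "\<lambda>j c k. if k = j then c else 0"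
  by (rule summable_finite[of "{j}" for j]) auto


definition complex_gaussian :: "real \<Rightarrow> complex measure" where
  "complex_gaussian s =
    density lborel (\<lambda>z. ennreal (exp (- ((Re z)\<^sup>2 + (Im z)\<^sup>2) / (2 * s\<^sup>2)) / (2 * pi * s\<^sup>2)))"

definition product_gaussian :: "(nat \<Rightarrow> real) \<Rightarrow> (nat \<Rightarrow> complex) measure" where
  "product_gaussian a = PiM UNIV (\<lambda>i. complex_gaussian (a i))"

text \<open>\<open>Abs_ell2\<close> identifies the square-summable sequences with the type \<open>ell2\<close>, so this
  is the restriction of the product measure to them; \<open>emeasure_P\<close> below makes this explicit.\<close>

definition P :: "(nat \<Rightarrow> real) \<Rightarrow> ell2 measure" where
  "P a = distr (restrict_space (product_gaussian a) (range coord)) borel Abs_ell2"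

lemma sets_product_gaussian: "sets (product_gaussian a) = sets borel"
proof -
  have "sets (product_gaussian a) = sets (PiM UNIV (\<lambda>i::nat. borel :: complex measure))"
    unfolding product_gaussian_def by (rule sets_PiM_cong) (simp_all add: complex_gaussian_def)
  then show ?thesis
    by (simp add: sets_PiM_equal_borel)
qed

lemma coord_single_coord: "coord (single_coord j c) k = (if k = j then c else 0)"
  by (simp add: single_coord.rep_eq)

lemma coord_add: "coord (z + w) k = coord z k + coord w k"
  by (simp add: plus_ell2.rep_eq)

lemma coord_diff: "coord (z - w) k = coord z k - coord w k"
  unfolding minus_ell2_def plus_ell2.rep_eq uminus_ell2.rep_eq by simp

lemma coord_sum: "coord (\<Sum>i\<in>A. g i) k = (\<Sum>i\<in>A. coord (g i) k)"
  by (induction A rule: infinite_finite_induct) (simp_all add: zero_ell2.rep_eq coord_add)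

lemma norm_single_coord: "norm (single_coord j c) = cmod c"
proof -
  have "(\<lambda>k. (cmod (coord (single_coord j c) k))\<^sup>2) = (\<lambda>k. if k = j then (cmod c)\<^sup>2 else 0)"
    by (auto simp: coord_single_coord)
  then show ?thesis
    using sums_single[of j "\<lambda>_. (cmod c)\<^sup>2"] by (simp add: norm_ell2_def sums_iff)
qed

lemma single_diff: "single_coord j c - single_coord j d = single_coord j (c - d)"
  by (rule ell2_eqI) (simp add: coord_diff coord_single_coord)

lemma continuous_single: "continuous_on UNIV (single_coord j)"
  unfolding continuous_on_iff dist_norm single_diff norm_single_coord by auto

lemma norm_coord_le: "cmod (coord z j) \<le> norm z"
proof -
  have "(cmod (coord z j))\<^sup>2 \<le> (\<Sum>j. (cmod (coord z j))\<^sup>2)"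
    using sum_le_suminf[OF summable_coord, of "{j}" z] by simp
  then show ?thesis
    by (simp add: norm_ell2_def real_le_rsqrt)
qed

lemma continuous_coord: "continuous_on UNIV coord"
proof (rule continuous_on_coordinatewise_then_product)
  fix j
  show "continuous_on UNIV (\<lambda>z. coord z j)"
    unfolding continuous_on_iff dist_norm coord_diff[symmetric]
    by (meson norm_coord_le le_less_trans)
qed

lemma truncation_LIMSEQ: "(\<lambda>n. \<Sum>j<n. single_coord j (coord z j)) \<longlonglongrightarrow> z"
proof -
  have "(\<lambda>n. norm ((\<Sum>j<n. single_coord j (coord z j)) - z)) \<longlonglongrightarrow> 0"
  proof -
    have nrm: "norm ((\<Sum>j<n. single_coord j (coord z j)) - z)
        = sqrt (\<Sum>k. (cmod (coord z (k + n)))\<^sup>2)" for n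
    proof -
      let ?g = "\<lambda>k. (cmod (coord ((\<Sum>j<n. single_coord j (coord z j)) - z) k))\<^sup>2"
      have g: "?g k = (if k < n then 0 else (cmod (coord z k))\<^sup>2)" for k
        by (simp add: coord_diff coord_sum coord_single_coord)
      have "(\<Sum>k. ?g k) = (\<Sum>k. ?g (k + n)) + (\<Sum>k<n. ?g k)"
        by (rule suminf_split_initial_segment) (rule summable_coord)
      also have "\<dots> = (\<Sum>k. (cmod (coord z (k + n)))\<^sup>2)"
        unfolding g by simp
      finally show ?thesis
        unfolding norm_ell2_def by (rule arg_cong)
    qed
    have "(\<lambda>n. sqrt (\<Sum>k. (cmod (coord z (k + n)))\<^sup>2)) \<longlonglongrightarrow> sqrt 0"
      by (intro tendsto_real_sqrt suminf_exist_split2 summable_coord)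
    then show ?thesis
      by (simp only: nrm real_sqrt_zero)
  qed
  then have "(\<lambda>n. (\<Sum>j<n. single_coord j (coord z j)) - z) \<longlonglongrightarrow> 0"
    by (simp only: tendsto_norm_zero_iff)
  then show ?thesis
    by (rule LIM_zero_cancel)
qed

lemma measurable_Abs_ell2:
  assumes "sets M = sets borel"
  shows "Abs_ell2 \<in> borel_measurable (restrict_space M (range coord))"
proof (rule borel_measurable_LIMSEQ_metric)
  fix n
  have "continuous_on UNIV (\<lambda>z. \<Sum>j<n. single_coord j (z j :: complex))"
    by (intro continuous_on_sum continuous_on_compose2[OF continuous_single]
        continuous_on_product_coordinates) auto
  then have "(\<lambda>z. \<Sum>j<n. single_coord j (z j)) \<in> borel_measurable borel"
    by (rule borel_measurable_continuous_onI)
  then have "(\<lambda>z. \<Sum>j<n. single_coord j (z j)) \<in> borel_measurable M"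
    using measurable_cong_sets[OF assms refl] by blast
  then show "(\<lambda>z. \<Sum>j<n. single_coord j (z j)) \<in> borel_measurable (restrict_space M (range coord))"
    by (rule measurable_restrict_space1)
next
  fix z
  assume "z \<in> space (restrict_space M (range coord))"
  then obtain w where "z = coord w"
    by (auto simp: space_restrict_space)
  then show "(\<lambda>n. \<Sum>j<n. single_coord j (z j)) \<longlonglongrightarrow> Abs_ell2 z"
    using truncation_LIMSEQ[of w] by (simp only: coord_inverse)
qed

lemma range_coord_borel: "range coord \<in> sets borel"
proof -
  have "range coord = {z. (\<Sum>j. ennreal ((cmod (z j))\<^sup>2)) < \<infinity>}"
  proof (intro set_eqI iffI)
    fix z :: "nat \<Rightarrow> complex"
    assume "z \<in> range coord"
    then show "z \<in> {z. (\<Sum>j. ennreal ((cmod (z j))\<^sup>2)) < \<infinity>}"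
      using summable_coord by (auto simp: suminf_ennreal2)
  next
    fix z :: "nat \<Rightarrow> complex"
    assume "z \<in> {z. (\<Sum>j. ennreal ((cmod (z j))\<^sup>2)) < \<infinity>}"
    then have "summable (\<lambda>j. (cmod (z j))\<^sup>2)"
      by (intro summable_suminf_not_top) (auto simp: top.not_eq_extremum)
    then show "z \<in> range coord"
      using type_definition.Rep_range[OF type_definition_ell2] by simp
  qed
  moreover have "(\<lambda>z. z j) \<in> borel_measurable (borel :: (nat \<Rightarrow> complex) measure)" for j
    by (intro borel_measurable_continuous_onI continuous_on_product_coordinates)
  then have "(\<lambda>z :: nat \<Rightarrow> complex. \<Sum>j. ennreal ((cmod (z j))\<^sup>2)) \<in> borel_measurable borel"
    by measurable
  then have "(\<lambda>z :: nat \<Rightarrow> complex. \<Sum>j. ennreal ((cmod (z j))\<^sup>2)) -` {..<\<infinity>} \<inter> space borel \<in> sets borel"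
    by (rule measurable_sets) simp
  then have "{z :: nat \<Rightarrow> complex. (\<Sum>j. ennreal ((cmod (z j))\<^sup>2)) < \<infinity>} \<in> sets borel"
    by (simp only: vimage_def lessThan_iff space_borel Int_UNIV_right)
  ultimately show ?thesis by (simp only:)
qed

lemma emeasure_P:
  assumes F: "F \<in> sets borel"
  shows "emeasure (P a) (coord -` F) = emeasure (product_gaussian a) (F \<inter> range coord)"
proof -
  let ?R = "restrict_space (product_gaussian a) (range coord)"
  have sp: "space (product_gaussian a) = UNIV"
    using sets_eq_imp_space_eq[OF sets_product_gaussian] by simp
  have "coord -` F \<in> sets borel"
    using measurable_sets[OF borel_measurable_continuous_onI[OF continuous_coord] F] by simp
  then have "emeasure (P a) (coord -` F) = emeasure ?R (Abs_ell2 -` (coord -` F) \<inter> space ?R)"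
    unfolding P_def by (intro emeasure_distr measurable_Abs_ell2 sets_product_gaussian)
  also have "Abs_ell2 -` (coord -` F) \<inter> space ?R = F \<inter> range coord"
    by (auto simp: space_restrict_space sp coord_inverse)
  also have "emeasure ?R (F \<inter> range coord) = emeasure (product_gaussian a) (F \<inter> range coord)"
    by (rule emeasure_restrict_space) (auto simp: sp sets_product_gaussian range_coord_borel)
  finally show ?thesis .
qed


definition Lip_ell2 :: "(ell2 \<Rightarrow> complex) set" where
  "Lip_ell2 = {f. \<forall>S. bounded S \<longrightarrow> (\<exists>C>0. C-lipschitz_on S f)}"

definition diff_quot :: "ell2 \<Rightarrow> (ell2 \<Rightarrow> complex) \<Rightarrow> ell2 \<Rightarrow> real \<Rightarrow> complex" where
  "diff_quot v f z \<tau> = (f (z + \<tau> *\<^sub>R v) - f z) / of_real \<tau>"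

definition has_partials :: "ell2 \<Rightarrow> (ell2 \<Rightarrow> complex) \<Rightarrow> bool" where
  "has_partials v f \<longleftrightarrow> (\<forall>z. \<exists>D. (diff_quot v f z \<longlongrightarrow> D) (at 0))"

definition partial :: "ell2 \<Rightarrow> (ell2 \<Rightarrow> complex) \<Rightarrow> ell2 \<Rightarrow> complex" where
  "partial v f z = Lim (at 0) (diff_quot v f z)"

text \<open>The directions of the real variables \<open>x\<^sub>j\<close> and \<open>y\<^sub>j\<close>.\<close>

abbreviation x_dir :: "nat \<Rightarrow> ell2" where "x_dir j \<equiv> single_coord j 1"
abbreviation y_dir :: "nat \<Rightarrow> ell2" where "y_dir j \<equiv> single_coord j \<i>"

primrec Ck_ell2 :: "nat \<Rightarrow> (ell2 \<Rightarrow> complex) set" where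
  "Ck_ell2 0 = {f. continuous_on UNIV f}"
| "Ck_ell2 (Suc k) = {f. continuous_on UNIV f \<and>
     (\<forall>j. \<forall>v\<in>{x_dir j, y_dir j}. has_partials v f \<and> partial v f \<in> Ck_ell2 k)}"

definition Cinf_ell2 :: "(ell2 \<Rightarrow> complex) set" where
  "Cinf_ell2 = (\<Inter>k. Ck_ell2 k)"

definition del :: "nat \<Rightarrow> (ell2 \<Rightarrow> complex) \<Rightarrow> ell2 \<Rightarrow> complex" where
  "del j f z = (partial (x_dir j) f z - \<i> * partial (y_dir j) f z) / 2"

definition delbar :: "nat \<Rightarrow> (ell2 \<Rightarrow> complex) \<Rightarrow> ell2 \<Rightarrow> complex" where
  "delbar j f z = (partial (x_dir j) f z + \<i> * partial (y_dir j) f z) / 2"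

text \<open>\<open>iter_op D \<alpha>\<close> is the composition of the powers \<open>D j ^^ \<alpha> j\<close>, with \<open>j\<close> increasing from the
  outermost factor to the innermost. It is only applied to \<open>Cinf_ell2\<close> functions, on which the
  operators \<open>del j\<close>, \<open>delbar j\<close> commute, so the order does not matter.\<close>

definition iter_op :: "(nat \<Rightarrow> ('f \<Rightarrow> 'f)) \<Rightarrow> (nat \<Rightarrow> nat) \<Rightarrow> 'f \<Rightarrow> 'f" where
  "iter_op D \<alpha> = foldr (\<lambda>j. D j ^^ \<alpha> j) (sorted_list_of_set {j. \<alpha> j \<noteq> 0})"

definition multi_index :: "(nat \<Rightarrow> nat) set" where
  "multi_index = {\<alpha>. finite {j. \<alpha> j \<noteq> 0}}"

definition C1F_ell2 :: "(ell2 \<Rightarrow> complex) set" where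
  "C1F_ell2 = {f \<in> Ck_ell2 1. \<forall>S. bounded S \<longrightarrow>
     (SUP z\<in>S. ennreal (cmod (f z))
        + (\<Sum>j. ennreal ((cmod (del j f z))\<^sup>2 + (cmod (delbar j f z))\<^sup>2))) < \<infinity>}"

definition CinfFinf_ell2 :: "(ell2 \<Rightarrow> complex) set" where
  "CinfFinf_ell2 = {f \<in> Cinf_ell2. \<forall>\<alpha>\<in>multi_index. \<forall>\<beta>\<in>multi_index.
     iter_op del \<alpha> (iter_op delbar \<beta> f) \<in> C1F_ell2}"

definition Cinf0_ell2 :: "(ell2 \<Rightarrow> complex) set" where
  "Cinf0_ell2 = {f \<in> Cinf_ell2. bounded (closure {z. f z \<noteq> 0}) \<and>
     (\<forall>\<alpha>\<in>multi_index. \<forall>\<beta>\<in>multi_index.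
        bounded (range (iter_op del \<alpha> (iter_op delbar \<beta> f))))}"

end

theory Submission
  imports Defs
begin

text \<open>
  Translating the Gaussian measure in a coordinate direction \<open>v = single_coord j c\<close> multiplies it by
  an explicit density. Therefore the increments of the mollification of \<open>f\<close> by \<open>\<theta>\<close> along \<open>v\<close> can be
  transferred from \<open>f\<close>, which is merely Lipschitz, to \<open>\<theta>\<close>, and the partial derivative along \<open>v\<close> is
  \<open>1/\<epsilon>\<close> times the mollification by \<open>T \<theta> = \<partial>\<^sub>v \<theta> - (\<zeta>\<^sub>j \<bullet> c / a\<^sub>j\<^sup>2) \<theta>\<close>. Smooth functions of bounded
  support all of whose iterated partial derivatives are bounded are stable under \<open>T\<close>, so this can be
  iterated, and every derivative of a mollification is again a mollification. Each of these is
  Lipschitz on bounded sets, and testing the Lipschitz estimate on finite combinations of the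
  coordinate directions bounds the sum of the squares of its partial derivatives. The convergence
  as \<open>\<epsilon> \<rightarrow> 0\<close> is immediate from the Lipschitz condition, because \<open>\<theta>\<close> has bounded support.
\<close>

section \<open>Partial derivatives\<close>

text \<open>\<open>ell2\<close> carries no analogue of Lebesgue measure, so a translation cannot
  simply be moved from one factor of the integrand to the other. A shift in one coordinate, however,
  changes a single factor of the product measure, and its density is elementary; hence everything is
  phrased for coordinate directions. Three quantities are unbounded on \<open>ell2\<close>: this
  density, the factor \<zeta>_j in T, and f. They are all controlled by one radius R outside which
  \<theta> and its derivatives vanish, so R is carried through every class of functions. The formula
  for T bounds each single partial derivative, but with a factor 1 / a_j^2 that is unbounded in j,
  so it says nothing about summability over j. The Lipschitz constant does, because it controls all
  directions at once. The bounds in \<open>Cinf0_ell2\<close> concern Wirtinger derivatives with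
  every \<open>del\<close> outside every \<open>delbar\<close>. Reaching arbitrary words in the real
  partial derivatives requires the symmetry of mixed derivatives, which is proved here by second
  differences.\<close>

definition coord_dirs :: "ell2 set" where
  "coord_dirs = (\<Union>j. {x_dir j, y_dir j})"

lemma x_dir_in_coord_dirs [simp]: "x_dir j \<in> coord_dirs"
  and y_dir_in_coord_dirs [simp]: "y_dir j \<in> coord_dirs"
  by (auto simp: coord_dirs_def)

lemma Ck_ell2_Suc_iff:
  "f \<in> Ck_ell2 (Suc k) \<longleftrightarrow>
    continuous_on UNIV f \<and> (\<forall>v\<in>coord_dirs. has_partials v f \<and> partial v f \<in> Ck_ell2 k)"
  by (auto simp: coord_dirs_def)

lemma continuous_on_Ck_ell2: "f \<in> Ck_ell2 k \<Longrightarrow> continuous_on UNIV f"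
  by (cases k) auto

text \<open>Along the line through \<open>z\<close> in direction \<open>v\<close> the limit is an
  ordinary derivative in one real variable, which opens the way to the product rule, the chain rule
  and the mean value inequality.\<close>

lemma tendsto_diff_quot_iff:
  "(diff_quot v f z \<longlongrightarrow> D) (at 0) \<longleftrightarrow>
    ((\<lambda>t. f (z + t *\<^sub>R v)) has_vector_derivative D) (at 0)"
proof -
  have "cmod (diff_quot v f z h - D) = cmod (f (z + h *\<^sub>R v) - f z - h *\<^sub>R D) / \<bar>h\<bar>" if "h \<noteq> 0" for h
  proof -
    have "diff_quot v f z h - D = (f (z + h *\<^sub>R v) - f z - h *\<^sub>R D) / of_real h"
      using that by (simp add: diff_quot_def scaleR_conv_of_real field_simps)
    then show ?thesis
      by (simp add: norm_divide)
  qed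
  then have "((\<lambda>h. cmod (diff_quot v f z h - D)) \<longlongrightarrow> 0) (at 0) \<longleftrightarrow>
      ((\<lambda>h. cmod (f (z + h *\<^sub>R v) - f z - h *\<^sub>R D) / \<bar>h\<bar>) \<longlongrightarrow> 0) (at 0)"
    by (intro filterlim_cong refl) (auto simp: eventually_at_filter)
  then show ?thesis
    unfolding has_vector_derivative_def has_derivative_at
    by (simp add: bounded_linear_scaleR_left tendsto_norm_zero_iff LIM_zero_iff)
qed

text \<open>\<open>has_partials\<close> speaks of every point, so moving the base point along the
  line gives the derivative at every \<open>s\<close>, as the mean value inequality
  requires.\<close>

lemma has_partials_vector_derivative:
  assumes "has_partials v f"
  shows "((\<lambda>t. f (z + t *\<^sub>R v)) has_vector_derivative partial v f (z + s *\<^sub>R v)) (at s)"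
proof -
  have "(diff_quot v f (z + s *\<^sub>R v) \<longlongrightarrow> partial v f (z + s *\<^sub>R v)) (at 0)"
    using assms unfolding has_partials_def partial_def
    by (metis tendsto_Lim trivial_limit_at)
  then have "((\<lambda>t. f (z + (s + t) *\<^sub>R v)) has_vector_derivative partial v f (z + s *\<^sub>R v)) (at 0)"
    by (simp add: tendsto_diff_quot_iff algebra_simps)
  then have "((\<lambda>t. f (z + (s + t) *\<^sub>R v)) \<circ> (\<lambda>t. t - s) has_vector_derivative
      1 *\<^sub>R partial v f (z + s *\<^sub>R v)) (at s)"
    by (intro vector_diff_chain_at) (auto intro!: derivative_eq_intros)
  then show ?thesis
    by (simp add: o_def)
qed

lemma has_partials_vector_derivative_0:
  assumes "has_partials v f"
  shows "((\<lambda>t. f (z + t *\<^sub>R v)) has_vector_derivative partial v f z) (at 0)"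
  using has_partials_vector_derivative[OF assms, of z 0] by simp

lemma partialsI:
  assumes "\<And>z. ((\<lambda>t. f (z + t *\<^sub>R v)) has_vector_derivative D z) (at 0)"
  shows "has_partials v f" and "partial v f = D"
proof -
  have lim: "(diff_quot v f z \<longlongrightarrow> D z) (at 0)" for z
    using assms by (simp add: tendsto_diff_quot_iff)
  then show "has_partials v f"
    by (auto simp: has_partials_def)
  show "partial v f = D"
    using lim by (auto simp: partial_def fun_eq_iff intro!: tendsto_Lim)
qed

text \<open>The two-term shape is the common form of all linearity and closure rules below.
  Coefficients such as \<open>1 *\<close> or \<open>0 *\<close> in later terms are there to match it
  literally.\<close>

lemma partial_lincomb:
  assumes "has_partials v f" "has_partials v g"
  shows "has_partials v (\<lambda>z. c * f z + d * g z)"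
    and "partial v (\<lambda>z. c * f z + d * g z) = (\<lambda>z. c * partial v f z + d * partial v g z)"
proof -
  have "((\<lambda>t. c * f (z + t *\<^sub>R v) + d * g (z + t *\<^sub>R v)) has_vector_derivative
      c * partial v f z + d * partial v g z) (at 0)" for z
    by (intro has_vector_derivative_add has_vector_derivative_mult_right
        has_partials_vector_derivative_0 assms)
  note partialsI[of "\<lambda>z. c * f z + d * g z", OF this]
  then show "has_partials v (\<lambda>z. c * f z + d * g z)"
    and "partial v (\<lambda>z. c * f z + d * g z) = (\<lambda>z. c * partial v f z + d * partial v g z)"
    by auto
qed

lemma Ck_ell2_lincomb:
  "f \<in> Ck_ell2 k \<Longrightarrow> g \<in> Ck_ell2 k \<Longrightarrow> (\<lambda>z. c * f z + d * g z) \<in> Ck_ell2 k"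
proof (induction k arbitrary: f g)
  case (Suc k)
  then show ?case
    unfolding Ck_ell2_Suc_iff by (auto simp: partial_lincomb intro!: continuous_intros)
qed (auto intro!: continuous_intros)

lemma Cinf_ell2_lincomb:
  "f \<in> Cinf_ell2 \<Longrightarrow> g \<in> Cinf_ell2 \<Longrightarrow> (\<lambda>z. c * f z + d * g z) \<in> Cinf_ell2"
  by (auto simp: Cinf_ell2_def intro: Ck_ell2_lincomb)

lemma Cinf_ell2D:
  assumes "f \<in> Cinf_ell2"
  shows "f \<in> Ck_ell2 k" and "continuous_on UNIV f"
    and "v \<in> coord_dirs \<Longrightarrow> has_partials v f"
    and "v \<in> coord_dirs \<Longrightarrow> partial v f \<in> Cinf_ell2"
proof -
  have *: "f \<in> Ck_ell2 k" for k
    using assms by (simp add: Cinf_ell2_def)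
  show "f \<in> Ck_ell2 k" by (rule *)
  show "continuous_on UNIV f" by (rule continuous_on_Ck_ell2[OF *[of 0]])
  show "has_partials v f" if "v \<in> coord_dirs"
    using *[of 1] that by (auto simp: Ck_ell2_Suc_iff simp del: Ck_ell2.simps)
  show "partial v f \<in> Cinf_ell2" if "v \<in> coord_dirs"
    using *[of "Suc _"] that by (auto simp: Ck_ell2_Suc_iff Cinf_ell2_def simp del: Ck_ell2.simps)
qed

section \<open>Mean value inequality and symmetry of mixed partial derivatives\<close>

text \<open>Mean value inequality for \<open>g t - t *\<^sub>R c\<close> on an interval symmetric
  about 0, so that both signs of \<open>h\<close> are covered. Taking \<open>c = 0\<close> bounds an
  increment; taking \<open>c\<close> to be a derivative bounds the remainder of a linear
  approximation.\<close>

lemma vector_derivative_increment_bound: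
  fixes g :: "real \<Rightarrow> 'a::real_normed_vector"
  assumes der: "\<And>s. \<bar>s\<bar> \<le> \<bar>h\<bar> \<Longrightarrow> (g has_vector_derivative g' s) (at s)"
    and B: "\<And>s. \<bar>s\<bar> \<le> \<bar>h\<bar> \<Longrightarrow> norm (g' s - c) \<le> B"
  shows "norm (g h - g 0 - h *\<^sub>R c) \<le> \<bar>h\<bar> * B"
proof -
  let ?S = "{-\<bar>h\<bar>..\<bar>h\<bar>}"
  have der': "((\<lambda>t. g t - t *\<^sub>R c) has_vector_derivative g' s - c) (at s within ?S)"
    if "s \<in> ?S" for s
  proof -
    have "((\<lambda>t. t *\<^sub>R c) has_vector_derivative c) (at s)"
      by (auto simp: has_vector_derivative_def intro!: derivative_eq_intros)
    moreover have "(g has_vector_derivative g' s) (at s)"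
      using that by (intro der) auto
    ultimately show ?thesis
      using has_vector_derivative_at_within has_vector_derivative_diff by blast
  qed
  have "norm ((\<lambda>t. g t - t *\<^sub>R c) h - (\<lambda>t. g t - t *\<^sub>R c) 0) \<le> B * norm (h - 0)"
  proof (rule differentiable_bound[where S = ?S])
    fix s assume s: "s \<in> ?S"
    show "((\<lambda>t. g t - t *\<^sub>R c) has_derivative (\<lambda>x. x *\<^sub>R (g' s - c))) (at s within ?S)"
      using der'[OF s] by (simp add: has_vector_derivative_def)
    have "norm (x *\<^sub>R (g' s - c)) \<le> B * norm x" for x
      using mult_right_mono[OF B[of s], of "\<bar>x\<bar>"] s by (auto simp: mult.commute)
    then show "onorm (\<lambda>x. x *\<^sub>R (g' s - c)) \<le> B"
      by (rule onorm_le)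
  qed auto
  then show ?thesis
    by (simp add: algebra_simps)
qed

lemma partial_increment_bound:
  assumes "has_partials v f"
    and "\<And>s. \<bar>s\<bar> \<le> \<bar>h\<bar> \<Longrightarrow> cmod (partial v f (z + s *\<^sub>R v) - c) \<le> B"
  shows "cmod (f (z + h *\<^sub>R v) - f z - h *\<^sub>R c) \<le> \<bar>h\<bar> * B"
proof -
  have "norm (f (z + h *\<^sub>R v) - f (z + 0 *\<^sub>R v) - h *\<^sub>R c) \<le> \<bar>h\<bar> * B"
    by (rule vector_derivative_increment_bound[OF has_partials_vector_derivative[OF assms(1)] assms(2)])
  then show ?thesis
    by simp
qed

text \<open>The second difference is symmetric in \<open>v\<close> and \<open>w\<close>, so applying this estimate in both orders
  identifies the two mixed derivatives.\<close>

lemma second_difference_bound: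
  assumes F: "has_partials v F" and vF: "has_partials w (partial v F)"
    and "norm v \<le> 1" "norm w \<le> 1" "0 < h" "2 * h < \<delta>"
    and B: "\<And>y. dist y z < \<delta> \<Longrightarrow> cmod (partial w (partial v F) y - partial w (partial v F) z) \<le> \<eta>"
  shows "cmod (F (z + h *\<^sub>R v + h *\<^sub>R w) - F (z + h *\<^sub>R w) - F (z + h *\<^sub>R v) + F z
      - h\<^sup>2 *\<^sub>R partial w (partial v F) z) \<le> h\<^sup>2 * \<eta>"
proof -
  let ?D = "partial w (partial v F) z"
  \<comment> \<open>Differencing along \<open>w\<close> leaves a function whose derivative along
    \<open>v\<close> is an increment of \<open>partial v F\<close> along \<open>w\<close>. The mean
    value bound is then used once in each direction, at points at distance at most
    \<open>2 * h\<close> from \<open>z\<close>.\<close>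
  define g where "g y = F (y + h *\<^sub>R w) - F y" for y
  have gd: "((\<lambda>t. g (y + t *\<^sub>R v)) has_vector_derivative
      partial v F (y + h *\<^sub>R w) - partial v F y) (at 0)" for y
    using has_partials_vector_derivative_0[OF F, of "y + h *\<^sub>R w"]
      has_partials_vector_derivative_0[OF F, of y]
    unfolding g_def by (auto intro!: has_vector_derivative_diff simp: algebra_simps)
  note g = partialsI[of g v, OF gd]
  have "cmod (g (z + h *\<^sub>R v) - g z - h *\<^sub>R (h *\<^sub>R ?D)) \<le> \<bar>h\<bar> * (\<bar>h\<bar> * \<eta>)"
  proof (rule partial_increment_bound[OF g(1)])
    fix s assume s: "\<bar>s\<bar> \<le> \<bar>h\<bar>"
    show "cmod (partial v g (z + s *\<^sub>R v) - h *\<^sub>R ?D) \<le> \<bar>h\<bar> * \<eta>"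
      unfolding g(2)
    proof (rule partial_increment_bound[OF vF])
      fix r assume r: "\<bar>r\<bar> \<le> \<bar>h\<bar>"
      have "norm (s *\<^sub>R v + r *\<^sub>R w) \<le> \<bar>s\<bar> * norm v + \<bar>r\<bar> * norm w"
        by (metis norm_scaleR norm_triangle_ineq)
      also have "\<dots> \<le> \<bar>h\<bar> * 1 + \<bar>h\<bar> * 1"
        using r s assms by (intro add_mono mult_mono) auto
      finally have "dist (z + s *\<^sub>R v + r *\<^sub>R w) z < \<delta>"
        using assms by (simp add: dist_norm add.assoc)
      then show "cmod (partial w (partial v F) (z + s *\<^sub>R v + r *\<^sub>R w) - ?D) \<le> \<eta>"
        by (rule B)
    qed
  qed
  then show ?thesis
    using \<open>0 < h\<close> by (simp add: g_def power2_eq_square algebra_simps)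
qed

lemma norm_coord_dirs: "v \<in> coord_dirs \<Longrightarrow> norm v = 1"
  by (auto simp: coord_dirs_def norm_single_coord)

lemma partial_commute:
  assumes F: "F \<in> Ck_ell2 2" and v: "v \<in> coord_dirs" and w: "w \<in> coord_dirs"
  shows "partial v (partial w F) = partial w (partial v F)"
proof
  fix z
  have *: "has_partials u F" "has_partials u' (partial u F)"
    "continuous_on UNIV (partial u' (partial u F))" if "u \<in> coord_dirs" "u' \<in> coord_dirs" for u u'
    using F that by (auto simp: numeral_2_eq_2 Ck_ell2_Suc_iff simp del: Ck_ell2.simps(2))
  let ?A = "partial v (partial w F)" and ?B = "partial w (partial v F)"
  have "cmod (?A z - ?B z) \<le> 2 * \<eta>" if "\<eta> > 0" for \<eta>
  proof -
    from *(3)[OF w v] \<open>\<eta> > 0\<close> obtain d1 where d1: "d1 > 0"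
      "\<And>y. dist y z < d1 \<Longrightarrow> cmod (?A y - ?A z) \<le> \<eta>"
      unfolding continuous_on_iff dist_norm by (meson UNIV_I less_imp_le)
    from *(3)[OF v w] \<open>\<eta> > 0\<close> obtain d2 where d2: "d2 > 0"
      "\<And>y. dist y z < d2 \<Longrightarrow> cmod (?B y - ?B z) \<le> \<eta>"
      unfolding continuous_on_iff dist_norm by (meson UNIV_I less_imp_le)
    define h where "h = min d1 d2 / 4"
    have h: "0 < h" "2 * h < d1" "2 * h < d2"
      using d1 d2 by (auto simp: h_def)
    let ?\<Delta> = "F (z + h *\<^sub>R v + h *\<^sub>R w) - F (z + h *\<^sub>R w) - F (z + h *\<^sub>R v) + F z"
    have "cmod (?\<Delta> - h\<^sup>2 *\<^sub>R ?B z) \<le> h\<^sup>2 * \<eta>"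
      by (rule second_difference_bound[OF *(1)[OF v v] *(2)[OF v w] _ _ h(1,3) d2(2)])
        (simp_all add: norm_coord_dirs v w)
    moreover have "cmod (?\<Delta> - h\<^sup>2 *\<^sub>R ?A z) \<le> h\<^sup>2 * \<eta>"
      using second_difference_bound[OF *(1)[OF w w] *(2)[OF w v] _ _ h(1,2) d1(2)]
      by (simp add: norm_coord_dirs v w algebra_simps)
    ultimately have "cmod (h\<^sup>2 *\<^sub>R ?A z - h\<^sup>2 *\<^sub>R ?B z) \<le> h\<^sup>2 * (2 * \<eta>)"
      using norm_triangle_ineq4[of "?\<Delta> - h\<^sup>2 *\<^sub>R ?B z" "?\<Delta> - h\<^sup>2 *\<^sub>R ?A z"] by simp
    then show ?thesis
      using h(1) by (simp flip: scaleR_diff_right)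
  qed
  \<comment> \<open>With a quarter of the gap as \<eta>, the gap would be at most half of
    itself.\<close>
  from this[of "cmod (?A z - ?B z) / 4"] show "?A z = ?B z"
    by (cases "?A z = ?B z") auto
qed

lemma Cinf_ell2_partial_commute:
  "F \<in> Cinf_ell2 \<Longrightarrow> v \<in> coord_dirs \<Longrightarrow> w \<in> coord_dirs \<Longrightarrow>
    partial v (partial w F) = partial w (partial v F)"
  by (intro partial_commute Cinf_ell2D)

text \<open>Common form of \<open>del\<close> (\<open>s = - \<i>\<close>) and \<open>delbar\<close> (\<open>s = \<i>\<close>).\<close>

definition wirt :: "complex \<Rightarrow> nat \<Rightarrow> (ell2 \<Rightarrow> complex) \<Rightarrow> ell2 \<Rightarrow> complex" where
  "wirt s j f = (\<lambda>z. 1 / 2 * partial (x_dir j) f z + s / 2 * partial (y_dir j) f z)"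

lemma del_eq_wirt: "del = wirt (- \<i>)" and delbar_eq_wirt: "delbar = wirt \<i>"
  by (auto simp: fun_eq_iff del_def delbar_def wirt_def field_simps)

lemma Cinf_ell2_wirt: "F \<in> Cinf_ell2 \<Longrightarrow> wirt s j F \<in> Cinf_ell2"
  unfolding wirt_def by (intro Cinf_ell2_lincomb Cinf_ell2D(4)) auto

lemma partial_wirt:
  assumes "F \<in> Cinf_ell2" "v \<in> coord_dirs"
  shows "partial v (wirt s j F) = wirt s j (partial v F)"
  unfolding wirt_def using assms
  by (subst partial_lincomb)
    (auto simp: Cinf_ell2_partial_commute[of F v] intro!: Cinf_ell2D)

lemma wirt_lincomb:
  "F \<in> Cinf_ell2 \<Longrightarrow> G \<in> Cinf_ell2 \<Longrightarrow>
    wirt s j (\<lambda>z. c * F z + d * G z) = (\<lambda>z. c * wirt s j F z + d * wirt s j G z)"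
  by (simp add: wirt_def partial_lincomb Cinf_ell2D fun_eq_iff algebra_simps)

lemma wirt_commute:
  assumes F: "F \<in> Cinf_ell2"
  shows "wirt s i (wirt t j F) = wirt t j (wirt s i F)"
proof -
  have "wirt s i (wirt t j F) =
      (\<lambda>z. 1 / 2 * wirt t j (partial (x_dir i) F) z + s / 2 * wirt t j (partial (y_dir i) F) z)"
    by (simp add: wirt_def[of s i] partial_wirt F)
  also have "\<dots> = wirt t j (wirt s i F)"
    by (simp only: wirt_def[of s i F] wirt_lincomb Cinf_ell2D(4)[OF F] x_dir_in_coord_dirs
        y_dir_in_coord_dirs)
  finally show ?thesis .
qed

lemma partial_x_eq_wirt: "partial (x_dir j) F = (\<lambda>z. 1 * del j F z + 1 * delbar j F z)"
  and partial_y_eq_wirt: "partial (y_dir j) F = (\<lambda>z. \<i> * del j F z + - \<i> * delbar j F z)"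
  by (auto simp: fun_eq_iff del_eq_wirt delbar_eq_wirt wirt_def algebra_simps)

section \<open>Iterated Wirtinger operators and multi-indices\<close>

text \<open>Flattening the powers into one word of indices turns a reordering of operators into a
  permutation of a list.\<close>

lemma iter_op_eq_foldr:
  "iter_op D \<alpha> = foldr D (concat (map (\<lambda>j. replicate (\<alpha> j) j) (sorted_list_of_set {j. \<alpha> j \<noteq> 0})))"
proof -
  have rep: "foldr D (replicate n j) = D j ^^ n" for n j
    by (induction n) auto
  have "foldr (\<lambda>j. D j ^^ \<alpha> j) xs = foldr D (concat (map (\<lambda>j. replicate (\<alpha> j) j) xs))" for xs
    by (induction xs) (auto simp: rep)
  then show ?thesis
    by (simp add: iter_op_def)
qed

lemma count_mset_concat_replicate:
  "distinct xs \<Longrightarrow> count (mset (concat (map (\<lambda>j. replicate (\<alpha> j) j) xs))) i = (if i \<in> set xs then \<alpha> i else 0)"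
  by (induction xs) auto

lemma iter_op_induct:
  assumes "F \<in> A" and "\<And>j F. F \<in> A \<Longrightarrow> D j F \<in> A"
  shows "iter_op D \<alpha> F \<in> A"
proof -
  have "foldr D xs F \<in> A" for xs
    using assms by (induction xs) auto
  then show ?thesis
    by (simp add: iter_op_eq_foldr)
qed

lemma multi_index_Suc:
  assumes "\<alpha> \<in> multi_index"
  shows "\<alpha>(j := Suc (\<alpha> j)) \<in> multi_index"
proof -
  have "{i. (\<alpha>(j := Suc (\<alpha> j))) i \<noteq> 0} \<subseteq> insert j {i. \<alpha> i \<noteq> 0}"
    by auto
  then show ?thesis
    using assms by (auto simp: multi_index_def simp del: fun_upd_apply intro: finite_subset)
qed

text \<open>The words \<open>j # L \<alpha>\<close> and
  \<open>L (\<alpha>(j := Suc (\<alpha> j)))\<close> have the same multiset of letters, and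
  commuting operators depend on nothing else. The invariant set \<open>A\<close> is present because
  commutation is known only for smooth functions.\<close>

lemma iter_op_Suc:
  assumes \<alpha>: "\<alpha> \<in> multi_index" and F: "F \<in> A" and D: "\<And>j F. F \<in> A \<Longrightarrow> D j F \<in> A"
    and comm: "\<And>i j F. F \<in> A \<Longrightarrow> D i (D j F) = D j (D i F)"
  shows "D j (iter_op D \<alpha> F) = iter_op D (\<alpha>(j := Suc (\<alpha> j))) F"
proof -
  define L where
    "L \<alpha> = concat (map (\<lambda>j. replicate (\<alpha> j) j) (sorted_list_of_set {j. \<alpha> j \<noteq> 0}))"
    for \<alpha> :: "nat \<Rightarrow> nat"
  have cnt: "count (mset (L \<alpha>)) = \<alpha>" if "\<alpha> \<in> multi_index" for \<alpha>
    using that unfolding L_def multi_index_def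
    by (subst fun_eq_iff) (auto simp: count_mset_concat_replicate simp del: mset_concat)
  have iter_op_L: "iter_op D \<alpha> = foldr D (L \<alpha>)" for \<alpha>
    by (simp only: L_def iter_op_eq_foldr)
  have "mset (j # L \<alpha>) = mset (L (\<alpha>(j := Suc (\<alpha> j))))"
    using \<alpha> by (intro multiset_eqI) (simp add: cnt multi_index_Suc)
  then have "fold D (rev (j # L \<alpha>)) F = fold D (rev (L (\<alpha>(j := Suc (\<alpha> j))))) F"
    by (intro fold_permuted_eq[where P = "\<lambda>F. F \<in> A"]) (auto intro: F D comm)
  then show ?thesis
    by (simp only: iter_op_L foldr_conv_fold rev.simps fold_append o_apply fold_simps)
qed

text \<open>The definition of \<open>Cinf0_ell2\<close> only bounds the derivatives in normal order. Since this span is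
  closed under partial derivatives, all iterated partial derivatives are bounded as well.\<close>

inductive_set derivative_span :: "(ell2 \<Rightarrow> complex) \<Rightarrow> (ell2 \<Rightarrow> complex) set" for \<theta> where
  base: "\<alpha> \<in> multi_index \<Longrightarrow> \<beta> \<in> multi_index \<Longrightarrow>
    iter_op del \<alpha> (iter_op delbar \<beta> \<theta>) \<in> derivative_span \<theta>"
| lincomb: "F \<in> derivative_span \<theta> \<Longrightarrow> G \<in> derivative_span \<theta> \<Longrightarrow>
    (\<lambda>z. c * F z + d * G z) \<in> derivative_span \<theta>"

lemma self_in_derivative_span: "\<theta> \<in> derivative_span \<theta>"
  using derivative_span.base[of "\<lambda>_. 0" "\<lambda>_. 0" \<theta>] by (simp add: multi_index_def iter_op_def)

lemma iter_op_wirt_commute: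
  assumes "F \<in> Cinf_ell2"
  shows "wirt s j (iter_op (wirt t) \<alpha> F) = iter_op (wirt t) \<alpha> (wirt s j F)"
proof -
  have "foldr (wirt t) xs F \<in> Cinf_ell2 \<and>
      wirt s j (foldr (wirt t) xs F) = foldr (wirt t) xs (wirt s j F)" for xs
    using assms by (induction xs) (auto simp: Cinf_ell2_wirt wirt_commute[of _ s])
  then show ?thesis
    by (simp add: iter_op_eq_foldr)
qed

lemma iter_op_wirt_Cinf: "F \<in> Cinf_ell2 \<Longrightarrow> iter_op (wirt s) \<alpha> F \<in> Cinf_ell2"
  by (rule iter_op_induct) (auto intro: Cinf_ell2_wirt)

lemma wirt_derivative_span:
  assumes \<theta>: "\<theta> \<in> Cinf_ell2" and F: "F \<in> derivative_span \<theta>"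
  shows "F \<in> Cinf_ell2 \<and> del j F \<in> derivative_span \<theta> \<and> delbar j F \<in> derivative_span \<theta>"
  using F
proof induction
  case (base \<alpha> \<beta>)
  have "del j (iter_op del \<alpha> (iter_op delbar \<beta> \<theta>)) =
      iter_op del (\<alpha>(j := Suc (\<alpha> j))) (iter_op delbar \<beta> \<theta>)"
    unfolding del_eq_wirt delbar_eq_wirt using \<theta> base
    by (intro iter_op_Suc[where A = Cinf_ell2] iter_op_wirt_Cinf Cinf_ell2_wirt wirt_commute)
  \<comment> \<open>The new \<open>delbar j\<close> starts outside the \<open>del\<close> factors;
    it is moved inside them before it can be absorbed into \<beta>.\<close>
  moreover have "delbar j (iter_op del \<alpha> (iter_op delbar \<beta> \<theta>)) =
      iter_op del \<alpha> (iter_op delbar (\<beta>(j := Suc (\<beta> j))) \<theta>)"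
    unfolding del_eq_wirt delbar_eq_wirt using \<theta> base
    by (subst iter_op_wirt_commute, simp add: iter_op_wirt_Cinf,
        subst iter_op_Suc[where A = Cinf_ell2])
      (auto intro: Cinf_ell2_wirt wirt_commute)
  ultimately show ?case
    using base \<theta> derivative_span.base[of _ _ \<theta>]
    by (simp add: multi_index_Suc del_eq_wirt delbar_eq_wirt iter_op_wirt_Cinf)
next
  case (lincomb F G c d)
  then show ?case
    by (simp add: Cinf_ell2_lincomb wirt_lincomb del_eq_wirt delbar_eq_wirt derivative_span.lincomb)
qed

lemma partial_derivative_span:
  assumes "\<theta> \<in> Cinf_ell2" "F \<in> derivative_span \<theta>" "v \<in> coord_dirs"
  shows "partial v F \<in> derivative_span \<theta>"
proof -
  note D = wirt_derivative_span[OF assms(1,2)]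
  consider j where "v = x_dir j" | j where "v = y_dir j"
    using assms(3) by (auto simp: coord_dirs_def)
  then show ?thesis
  proof cases
    case (1 j)
    then show ?thesis
      unfolding 1 partial_x_eq_wirt using D by (blast intro: derivative_span.lincomb)
  next
    case (2 j)
    then show ?thesis
      unfolding 2 partial_y_eq_wirt using D by (blast intro: derivative_span.lincomb)
  qed
qed


section \<open>Translates of the Gaussian measure\<close>

lemma sets_complex_gaussian [measurable_cong, simp]: "sets (complex_gaussian s) = sets borel"
  and space_complex_gaussian [simp]: "space (complex_gaussian s) = UNIV"
  by (simp_all add: complex_gaussian_def)

text \<open>The density is the product of two centred normal densities of standard deviation
  \<open>s\<close>, one for each basis vector of the plane, so the total mass factors.\<close>

lemma prob_space_complex_gaussian:
  assumes "0 < s"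
  shows "prob_space (complex_gaussian s)"
proof
  interpret n: prob_space "density lborel (normal_density 0 s)"
    by (rule prob_space_normal_density[OF assms])
  have n: "(\<integral>\<^sup>+x. ennreal (normal_density 0 s x) \<partial>lborel) = 1"
    using n.emeasure_space_1 by (simp add: emeasure_density)
  have "ennreal (exp (- ((Re z)\<^sup>2 + (Im z)\<^sup>2) / (2 * s\<^sup>2)) / (2 * pi * s\<^sup>2)) =
      (\<Prod>b\<in>Basis. ennreal (normal_density 0 s (z \<bullet> b)))" for z
  proof -
    have "exp (- ((Re z)\<^sup>2 + (Im z)\<^sup>2) / (2 * s\<^sup>2)) / (2 * pi * s\<^sup>2) =
        normal_density 0 s (Re z) * normal_density 0 s (Im z)"
      using assms
      by (simp add: normal_density_def exp_add[symmetric] real_sqrt_mult field_simps power2_eq_square)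
    then show ?thesis
      by (simp add: Basis_complex_def ennreal_mult)
  qed
  then have "emeasure (complex_gaussian s) (space (complex_gaussian s)) =
      (\<integral>\<^sup>+z. (\<Prod>b\<in>Basis. ennreal (normal_density 0 s ((z :: complex) \<bullet> b))) \<partial>lborel)"
    unfolding complex_gaussian_def
    by (subst emeasure_density) (auto intro!: nn_integral_cong)
  also have "\<dots> = (\<Prod>b\<in>(Basis :: complex set). (\<integral>\<^sup>+x. ennreal (normal_density 0 s x) \<partial>lborel))"
    by (rule nn_integral_lborel_prod) auto
  also have "\<dots> = 1"
    by (simp add: n)
  finally show "emeasure (complex_gaussian s) (space (complex_gaussian s)) = 1" .
qed

text \<open>Density, with respect to \<open>complex_gaussian s\<close>, of its image under \<open>x \<mapsto> x - d\<close>.\<close>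

definition shift_density :: "real \<Rightarrow> complex \<Rightarrow> complex \<Rightarrow> real" where
  "shift_density s d x = exp (- (2 * (x \<bullet> d) + (cmod d)\<^sup>2) / (2 * s\<^sup>2))"

lemma shift_density_pos: "0 < shift_density s d x"
  by (simp add: shift_density_def)

lemma measurable_shift_density [measurable]: "shift_density s d \<in> borel_measurable borel"
  unfolding shift_density_def by measurable

text \<open>Translation invariance of Lebesgue measure moves the shift onto the density
  \<open>p\<close>; expanding the square of |x + d| shows that \<open>p (d + x)\<close> is
  \<open>p x\<close> times \<open>shift_density s d x\<close>.\<close>

lemma nn_integral_complex_gaussian_shift:
  assumes [measurable]: "h \<in> borel_measurable borel" and "s > 0"
  shows "(\<integral>\<^sup>+x. h (x - d) \<partial>complex_gaussian s) =
    (\<integral>\<^sup>+x. ennreal (shift_density s d x) * h x \<partial>complex_gaussian s)"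
proof -
  define p where "p z = exp (- ((Re z)\<^sup>2 + (Im z)\<^sup>2) / (2 * s\<^sup>2)) / (2 * pi * s\<^sup>2)" for z
  have [measurable]: "p \<in> borel_measurable borel"
    unfolding p_def by measurable
  have p: "0 \<le> p x" for x
    by (simp add: p_def)
  have cg: "complex_gaussian s = density lborel p"
    by (simp add: complex_gaussian_def p_def)
  have pd: "p (d + x) = p x * shift_density s d x" for x
  proof -
    have "- ((Re (d + x))\<^sup>2 + (Im (d + x))\<^sup>2) / (2 * s\<^sup>2) =
        - ((Re x)\<^sup>2 + (Im x)\<^sup>2) / (2 * s\<^sup>2) + - (2 * (x \<bullet> d) + (cmod d)\<^sup>2) / (2 * s\<^sup>2)"
      unfolding add_divide_distrib[symmetric] cmod_power2
      by (simp add: inner_complex_def power2_eq_square algebra_simps)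
    then show ?thesis
      by (simp only: p_def shift_density_def exp_add times_divide_eq_left)
  qed
  have "(\<integral>\<^sup>+x. h (x - d) \<partial>complex_gaussian s) = (\<integral>\<^sup>+x. p x * h (x - d) \<partial>lborel)"
    unfolding cg by (rule nn_integral_density) auto
  also have "\<dots> = (\<integral>\<^sup>+x. p x * h (x - d) \<partial>distr lborel borel ((+) d))"
    by (simp add: lborel_distr_plus)
  also have "\<dots> = (\<integral>\<^sup>+x. p (d + x) * h x \<partial>lborel)"
    by (subst nn_integral_distr) auto
  also have "\<dots> = (\<integral>\<^sup>+x. p x * (ennreal (shift_density s d x) * h x) \<partial>lborel)"
    by (simp add: pd ennreal_mult p less_imp_le shift_density_pos mult.assoc)
  also have "\<dots> = (\<integral>\<^sup>+x. ennreal (shift_density s d x) * h x \<partial>complex_gaussian s)"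
    unfolding cg by (rule nn_integral_density[symmetric]) auto
  finally show ?thesis .
qed

section \<open>Shifting one coordinate of the product measure\<close>

lemma measurable_PiM_fun_upd:
  "(\<lambda>(x, X). X(j := x)) \<in> measurable (M j \<Otimes>\<^sub>M PiM (UNIV - {j}) M) (PiM UNIV M)"
  unfolding case_prod_unfold by (rule measurable_fun_upd[where J = "UNIV - {j}"]) auto

text \<open>Tonelli's theorem with coordinate \<open>j\<close> as the inner variable, so that a
  formula for one factor can be applied while the other coordinates are frozen.\<close>

lemma nn_integral_PiM_split_coordinate:
  fixes M :: "'i \<Rightarrow> 'a measure"
  assumes M: "\<And>i. prob_space (M i)" and H [measurable]: "H \<in> borel_measurable (PiM UNIV M)"
  shows "(\<integral>\<^sup>+w. H w \<partial>PiM UNIV M) =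
    (\<integral>\<^sup>+X. (\<integral>\<^sup>+x. H (X(j := x)) \<partial>M j) \<partial>PiM (UNIV - {j}) M)"
proof -
  let ?I = "UNIV - {j}"
  have up [measurable]: "(\<lambda>(x, X). X(j := x)) \<in> measurable (M j \<Otimes>\<^sub>M PiM ?I M) (PiM UNIV M)"
    by (rule measurable_PiM_fun_upd)
  interpret Mj: prob_space "M j" by (rule M)
  interpret I: prob_space "PiM ?I M" by (intro prob_space_PiM M)
  interpret pair_sigma_finite "M j" "PiM ?I M" ..
  have "PiM UNIV M = distr (M j \<Otimes>\<^sub>M PiM ?I M) (PiM UNIV M) (\<lambda>(x, X). X(j := x))"
    using distr_pair_PiM_eq_PiM[of ?I M j] M by (simp add: insert_absorb)
  then have "(\<integral>\<^sup>+w. H w \<partial>PiM UNIV M) =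
      (\<integral>\<^sup>+w. H w \<partial>distr (M j \<Otimes>\<^sub>M PiM ?I M) (PiM UNIV M) (\<lambda>(x, X). X(j := x)))"
    by simp
  also have "\<dots> = (\<integral>\<^sup>+p. H ((\<lambda>(x, X). X(j := x)) p) \<partial>(M j \<Otimes>\<^sub>M PiM ?I M))"
    by (rule nn_integral_distr) measurable
  also have "\<dots> = (\<integral>\<^sup>+X. (\<integral>\<^sup>+x. H (X(j := x)) \<partial>M j) \<partial>PiM ?I M)"
    using nn_integral_snd[of "\<lambda>p. H ((\<lambda>(x, X). X(j := x)) p)"] measurable_comp[OF up H]
    by (simp add: o_def)
  finally show "(\<integral>\<^sup>+w. H w \<partial>PiM UNIV M) =
      (\<integral>\<^sup>+X. (\<integral>\<^sup>+x. H (X(j := x)) \<partial>M j) \<partial>PiM ?I M)" .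
qed

text \<open>After splitting off coordinate \<open>j\<close>, both inner integrals live on the single
  plane that the shift affects, and there they agree.\<close>

lemma nn_integral_product_gaussian_shift:
  assumes a: "\<And>i. 0 < a i" and H: "H \<in> borel_measurable (product_gaussian a)"
  shows "(\<integral>\<^sup>+w. H (w(j := w j - d)) \<partial>product_gaussian a) =
    (\<integral>\<^sup>+w. ennreal (shift_density (a j) d (w j)) * H w \<partial>product_gaussian a)"
proof -
  let ?M = "\<lambda>i. complex_gaussian (a i)"
  note split = nn_integral_PiM_split_coordinate[of ?M, OF prob_space_complex_gaussian[OF a]]
  have [measurable]: "H \<in> borel_measurable (PiM UNIV ?M)"
    using H by (simp add: product_gaussian_def)
  have up [measurable]: "(\<lambda>w. w(j := w j - d)) \<in> measurable (PiM UNIV ?M) (PiM UNIV ?M)"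
    by (rule measurable_fun_upd[where J = UNIV]) auto
  have "(\<integral>\<^sup>+x. H ((X(j := x))(j := (X(j := x)) j - d)) \<partial>?M j) =
      (\<integral>\<^sup>+x. ennreal (shift_density (a j) d ((X(j := x)) j)) * H (X(j := x)) \<partial>?M j)"
    if X: "X \<in> space (PiM (UNIV - {j}) ?M)" for X
  proof -
    have "(\<lambda>x. H (X(j := x))) \<in> borel_measurable (?M j)"
      using measurable_comp[OF measurable_comp[OF measurable_Pair2'[OF X] measurable_PiM_fun_upd]
          H[unfolded product_gaussian_def]]
      by (simp add: o_def)
    then have "(\<lambda>x. H (X(j := x))) \<in> borel_measurable borel"
      using measurable_cong_sets[OF sets_complex_gaussian refl] by blast
    from nn_integral_complex_gaussian_shift[OF this a] show ?thesis
      by simp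
  qed
  then show ?thesis
    unfolding product_gaussian_def
    by (subst (1 2) split[where j = j]) (measurable, rule nn_integral_cong)
qed

section \<open>Transfer of the shift formula to \<open>P\<close>\<close>

lemma sets_P [measurable_cong, simp]: "sets (P a) = sets borel"
  and space_P [simp]: "space (P a) = UNIV"
  by (simp_all add: P_def)

text \<open>\<open>Abs_ell2\<close> is unspecified off \<open>range coord\<close>; the indicator
  removes those values from the integrand.\<close>

lemma nn_integral_P:
  assumes "h \<in> borel_measurable borel"
  shows "(\<integral>\<^sup>+\<zeta>. h \<zeta> \<partial>P a) =
    (\<integral>\<^sup>+w. h (Abs_ell2 w) * indicator (range coord) w \<partial>product_gaussian a)"
proof -
  have "space (product_gaussian a) = UNIV"
    using sets_eq_imp_space_eq[OF sets_product_gaussian] by simp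
  then show ?thesis
    unfolding P_def
    by (subst nn_integral_distr)
      (simp_all add: measurable_Abs_ell2 sets_product_gaussian assms
        nn_integral_restrict_space range_coord_borel)
qed

lemma finite_measure_P:
  assumes "\<And>i. 0 < a i"
  shows "finite_measure (P a)"
proof
  interpret prob_space "product_gaussian a"
    unfolding product_gaussian_def by (intro prob_space_PiM prob_space_complex_gaussian assms)
  have "emeasure (P a) (coord -` UNIV) = emeasure (product_gaussian a) (UNIV \<inter> range coord)"
    by (rule emeasure_P) simp
  then show "emeasure (P a) (space (P a)) \<noteq> \<infinity>"
    by simp
qed

lemma continuous_on_coord: "continuous_on UNIV (\<lambda>z. coord z j)"
  using continuous_on_product_then_coordinatewise[OF continuous_coord] .

lemma measurable_coord [measurable]: "(\<lambda>z. coord z j) \<in> borel_measurable borel"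
  by (rule borel_measurable_continuous_onI[OF continuous_on_coord])

lemma borel_measurable_shift:
  fixes h :: "ell2 \<Rightarrow> 'b::topological_space"
  assumes "h \<in> borel_measurable borel"
  shows "(\<lambda>\<zeta>. h (\<zeta> - v)) \<in> borel_measurable borel"
proof -
  have "(\<lambda>\<zeta>. \<zeta> - v) \<in> borel_measurable borel"
    by (intro borel_measurable_continuous_onI continuous_intros)
  from measurable_comp[OF this assms] show ?thesis
    by (simp add: o_def)
qed

text \<open>\<open>H\<close> extends \<open>h\<close> by 0 to all sequences. Since changing one
  coordinate neither creates nor destroys square-summability, shifting \<open>h\<close> on
  \<open>ell2\<close> and shifting \<open>H\<close> on sequences are the same operation.\<close>

lemma nn_integral_P_shift:
  assumes a: "\<And>i. 0 < a i" and h: "h \<in> borel_measurable borel"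
  shows "(\<integral>\<^sup>+\<zeta>. h (\<zeta> - single_coord j d) \<partial>P a) =
    (\<integral>\<^sup>+\<zeta>. ennreal (shift_density (a j) d (coord \<zeta> j)) * h \<zeta> \<partial>P a)"
proof -
  define H where "H w = h (Abs_ell2 w) * indicator (range coord) w" for w
  have H: "H \<in> borel_measurable (product_gaussian a)"
  proof -
    have "(\<lambda>w. h (Abs_ell2 w)) \<in> borel_measurable (restrict_space (product_gaussian a) (range coord))"
      using measurable_comp[OF measurable_Abs_ell2[OF sets_product_gaussian] h] by (simp add: o_def)
    then show ?thesis
      unfolding H_def
      by (subst (asm) borel_measurable_restrict_space_iff_ennreal)
        (auto simp: sets_product_gaussian range_coord_borel
          sets_eq_imp_space_eq[OF sets_product_gaussian])
  qed
  have shift_coord: "(coord z)(j := coord z j - e) = coord (z - single_coord j e)" for z e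
    by (auto simp: fun_eq_iff coord_diff coord_single_coord)
  have "h (Abs_ell2 w - single_coord j d) * indicator (range coord) w = H (w(j := w j - d))" for w
  proof (cases "w \<in> range coord")
    case True
    then obtain z where w: "w = coord z" by auto
    then show ?thesis
      by (simp add: w shift_coord H_def coord_inverse)
  next
    case False
    \<comment> \<open>Otherwise the opposite shift, which stays inside \<open>ell2\<close>, would
      recover \<open>w\<close>.\<close>
    have "w(j := w j - d) \<notin> range coord"
    proof
      assume "w(j := w j - d) \<in> range coord"
      then obtain z where z: "w(j := w j - d) = coord z" by auto
      have "w = coord (z - single_coord j (- d))"
        unfolding shift_coord[symmetric] z[symmetric] by auto
      with False show False by blast
    qed
    with False show ?thesis
      by (simp add: H_def)
  qed
  then have "(\<integral>\<^sup>+\<zeta>. h (\<zeta> - single_coord j d) \<partial>P a) =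
      (\<integral>\<^sup>+w. H (w(j := w j - d)) \<partial>product_gaussian a)"
    by (simp only: nn_integral_P[OF borel_measurable_shift[OF h]])
  also have "\<dots> = (\<integral>\<^sup>+w. ennreal (shift_density (a j) d (w j)) * H w \<partial>product_gaussian a)"
    by (rule nn_integral_product_gaussian_shift[OF a H])
  also have "\<dots> = (\<integral>\<^sup>+\<zeta>. ennreal (shift_density (a j) d (coord \<zeta> j)) * h \<zeta> \<partial>P a)"
  proof -
    have "(\<lambda>\<zeta>. ennreal (shift_density (a j) d (coord \<zeta> j)) * h \<zeta>) \<in> borel_measurable borel"
      using h by measurable
    moreover have "ennreal (shift_density (a j) d (w j)) * H w =
        ennreal (shift_density (a j) d (coord (Abs_ell2 w) j)) * h (Abs_ell2 w)
          * indicator (range coord) w" for w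
    proof (cases "w \<in> range coord")
      case True
      then obtain z where "w = coord z" by auto
      then show ?thesis
        by (simp add: H_def coord_inverse)
    qed (simp add: H_def)
    ultimately show ?thesis
      by (simp only: nn_integral_P)
  qed
  finally show ?thesis .
qed

text \<open>As an equality of measures the identity passes from nonnegative to complex integrands
  without cutting functions into real, imaginary, positive and negative parts.\<close>

lemma distr_P_shift:
  assumes a: "\<And>i. 0 < a i"
  shows "distr (P a) borel (\<lambda>\<zeta>. \<zeta> - single_coord j d) =
    density (P a) (\<lambda>\<zeta>. shift_density (a j) d (coord \<zeta> j))"
proof (rule measure_eqI)
  fix A assume "A \<in> sets (distr (P a) borel (\<lambda>\<zeta>. \<zeta> - single_coord j d))"
  then have A [measurable]: "A \<in> sets borel" by simp
  have [measurable]: "(\<lambda>\<zeta>. \<zeta> - single_coord j d) \<in> borel_measurable borel"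
    by (rule borel_measurable_shift) simp
  have "emeasure (distr (P a) borel (\<lambda>\<zeta>. \<zeta> - single_coord j d)) A =
      (\<integral>\<^sup>+\<zeta>. indicator A \<zeta> \<partial>distr (P a) borel (\<lambda>\<zeta>. \<zeta> - single_coord j d))"
    by simp
  also have "\<dots> = (\<integral>\<^sup>+\<zeta>. indicator A (\<zeta> - single_coord j d) \<partial>P a)"
    by (rule nn_integral_distr) auto
  also have "\<dots> = (\<integral>\<^sup>+\<zeta>. ennreal (shift_density (a j) d (coord \<zeta> j)) * indicator A \<zeta> \<partial>P a)"
    by (rule nn_integral_P_shift[OF a]) simp
  also have "\<dots> = emeasure (density (P a) (\<lambda>\<zeta>. shift_density (a j) d (coord \<zeta> j))) A"
    by (rule emeasure_density[symmetric]) auto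
  finally show "emeasure (distr (P a) borel (\<lambda>\<zeta>. \<zeta> - single_coord j d)) A =
      emeasure (density (P a) (\<lambda>\<zeta>. shift_density (a j) d (coord \<zeta> j))) A" .
qed simp

lemma integral_P_shift:
  fixes h :: "ell2 \<Rightarrow> complex"
  assumes a: "\<And>i. 0 < a i" and h: "h \<in> borel_measurable borel"
  shows "(\<integral>\<zeta>. h (\<zeta> - single_coord j d) \<partial>P a) =
    (\<integral>\<zeta>. shift_density (a j) d (coord \<zeta> j) *\<^sub>R h \<zeta> \<partial>P a)"
proof -
  have hP: "h \<in> borel_measurable (P a)"
    using h measurable_cong_sets[OF sets_P refl] by blast
  have "(\<lambda>\<zeta>. \<zeta> - single_coord j d) \<in> borel_measurable borel"
    by (rule borel_measurable_shift) simp
  then have "(\<integral>\<zeta>. h (\<zeta> - single_coord j d) \<partial>P a) =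
      (\<integral>\<zeta>. h \<zeta> \<partial>distr (P a) borel (\<lambda>\<zeta>. \<zeta> - single_coord j d))"
    by (subst integral_distr) (auto simp: h)
  also have "\<dots> = (\<integral>\<zeta>. shift_density (a j) d (coord \<zeta> j) *\<^sub>R h \<zeta> \<partial>P a)"
    unfolding distr_P_shift[OF a]
    by (rule integral_density) (auto simp: hP less_imp_le shift_density_pos)
  finally show ?thesis .
qed


section \<open>Lipschitz functions with continuous partial derivatives\<close>

text \<open>The classical argument that continuous partial derivatives give differentiability, for
  finitely many directions. The last direction is traversed from the moving point
  \<open>z + t *\<^sub>R u\<close>, and continuity of \<open>partial (v n) g\<close> at
  \<open>z\<close> controls the derivative there.\<close>

lemma has_vector_derivative_sum_directions:
  fixes v :: "nat \<Rightarrow> ell2"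
  assumes "\<And>k. has_partials (v k) g" and "\<And>k. continuous_on UNIV (partial (v k) g)"
  shows "((\<lambda>t. g (z + t *\<^sub>R (\<Sum>k<n. r k *\<^sub>R v k))) has_vector_derivative
    (\<Sum>k<n. r k *\<^sub>R partial (v k) g z)) (at 0)"
proof (induction n)
  case 0
  show ?case by simp
next
  case (Suc n)
  define u where "u = (\<Sum>k<n. r k *\<^sub>R v k)"
  define D where "D = partial (v n) g"
  define h where "h t = g (z + t *\<^sub>R u + (t * r n) *\<^sub>R v n) - g (z + t *\<^sub>R u)" for t
  have "(h has_derivative (\<lambda>t. t *\<^sub>R r n *\<^sub>R D z)) (at 0)"
    unfolding has_derivative_at_alt
  proof (intro conjI allI impI bounded_linear_scaleR_left)
    fix e :: real assume "0 < e"
    then have "0 < e / (\<bar>r n\<bar> + 1)" by simp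
    then obtain \<delta> where \<delta>: "\<delta> > 0" "\<And>y. dist y z < \<delta> \<Longrightarrow> cmod (D y - D z) \<le> e / (\<bar>r n\<bar> + 1)"
      using assms(2)[of n] unfolding D_def continuous_on_iff dist_norm
      by (meson UNIV_I less_imp_le)
    \<comment> \<open>Every point \<open>z + t *\<^sub>R u + s *\<^sub>R v n\<close> on the segment
      lies within |t| m of \<open>z\<close>; the summand 1 keeps \<open>m\<close> positive.\<close>
    define m where "m = norm u + \<bar>r n\<bar> * norm (v n) + 1"
    have "m > 0"
      by (simp add: m_def add_nonneg_pos)
    show "\<exists>d>0. \<forall>t. norm (t - 0) < d \<longrightarrow>
        norm (h t - h 0 - (t - 0) *\<^sub>R r n *\<^sub>R D z) \<le> e * norm (t - 0)"
    proof (intro exI[of _ "\<delta> / m"] conjI allI impI)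
      fix t :: real assume "norm (t - 0) < \<delta> / m"
      then have t: "\<bar>t\<bar> * m < \<delta>"
        using \<open>m > 0\<close> by (simp add: field_simps)
      have "cmod (g (z + t *\<^sub>R u + (t * r n) *\<^sub>R v n) - g (z + t *\<^sub>R u) - (t * r n) *\<^sub>R D z)
          \<le> \<bar>t * r n\<bar> * (e / (\<bar>r n\<bar> + 1))"
      proof (rule partial_increment_bound[OF assms(1)])
        fix s assume s: "\<bar>s\<bar> \<le> \<bar>t * r n\<bar>"
        have "norm (t *\<^sub>R u + s *\<^sub>R v n) \<le> \<bar>t\<bar> * norm u + \<bar>s\<bar> * norm (v n)"
          by (metis norm_scaleR norm_triangle_ineq)
        also have "\<dots> \<le> \<bar>t\<bar> * norm u + \<bar>t * r n\<bar> * norm (v n)"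
          by (intro add_left_mono mult_right_mono s) auto
        also have "\<dots> \<le> \<bar>t\<bar> * m"
          by (simp add: m_def algebra_simps abs_mult)
        finally have "dist (z + t *\<^sub>R u + s *\<^sub>R v n) z < \<delta>"
          using t by (simp add: dist_norm add.assoc)
        then show "cmod (partial (v n) g (z + t *\<^sub>R u + s *\<^sub>R v n) - D z) \<le> e / (\<bar>r n\<bar> + 1)"
          using \<delta>(2) by (simp add: D_def)
      qed
      also have "\<dots> \<le> e * \<bar>t\<bar>"
      proof -
        have "\<bar>r n\<bar> * (e / (\<bar>r n\<bar> + 1)) \<le> e"
          using \<open>0 < e\<close> by (simp add: field_simps)
        from mult_left_mono[OF this, of "\<bar>t\<bar>"] show ?thesis
          by (simp add: abs_mult algebra_simps)
      qed
      finally show "norm (h t - h 0 - (t - 0) *\<^sub>R r n *\<^sub>R D z) \<le> e * norm (t - 0)"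
        by (simp add: h_def)
    qed (use \<delta> \<open>m > 0\<close> in auto)
  qed
  then have "(h has_vector_derivative r n *\<^sub>R D z) (at 0)"
    by (simp add: has_vector_derivative_def)
  \<comment> \<open>\<open>h\<close> is the increment along the last direction, so adding
    \<open>g (z + t *\<^sub>R u)\<close> telescopes to the sum of \<open>Suc n\<close>
    directions.\<close>
  from has_vector_derivative_add[OF this Suc.IH] show ?case
    by (simp add: h_def u_def D_def algebra_simps)
qed

section \<open>Square-summability of the partial derivatives\<close>

lemma norm_sum_single_coord:
  assumes "cmod c = 1"
  shows "(norm (\<Sum>k<n. r k *\<^sub>R single_coord k c))\<^sup>2 = (\<Sum>k<n. (r k)\<^sup>2)"
proof -
  have "orthogonal (r i *\<^sub>R single_coord i c) (r j *\<^sub>R single_coord j c)" if "i \<noteq> j" for i j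
  proof -
    have "(\<lambda>k. coord (single_coord i c) k \<bullet> coord (single_coord j c) k) = (\<lambda>k. 0)"
      using that by (auto simp: coord_single_coord)
    then have "single_coord i c \<bullet> single_coord j c = 0"
      by (simp only: inner_ell2_def suminf_zero)
    then show ?thesis
      by (simp add: orthogonal_def)
  qed
  then show ?thesis
    using norm_sum_Pythagorean[of "{..<n}" "\<lambda>k. r k *\<^sub>R single_coord k c"] assms
    by (simp add: pairwise_def norm_single_coord)
qed

text \<open>Near \<open>t = 0\<close> all difference quotients along a combination \<open>u\<close>
  are at most \<open>C * norm u\<close>, and so is their limit. By duality this is an l2 bound on
  the vector of partial derivatives that does not depend on \<open>n\<close>.\<close>

lemma sum_partials_lipschitz_bound:
  assumes g: "\<And>k. has_partials (single_coord k c) g"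
      "\<And>k. continuous_on UNIV (partial (single_coord k c) g)"
    and c: "cmod c = 1"
    and lip: "C-lipschitz_on (ball z 1) g"
  shows "cmod (\<Sum>k<n. r k *\<^sub>R partial (single_coord k c) g z) \<le> C * sqrt (\<Sum>k<n. (r k)\<^sup>2)"
proof -
  define u where "u = (\<Sum>k<n. r k *\<^sub>R single_coord k c)"
  define E where "E = (\<Sum>k<n. r k *\<^sub>R partial (single_coord k c) g z)"
  have u: "norm u = sqrt (\<Sum>k<n. (r k)\<^sup>2)"
    using norm_sum_single_coord[OF c, where n = n and r = r] by (simp add: u_def real_sqrt_unique)
  have lim: "(diff_quot u g z \<longlongrightarrow> E) (at 0)"
    using has_vector_derivative_sum_directions[OF g, where n = n and r = r and z = z]
    by (simp add: tendsto_diff_quot_iff u_def E_def)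
  have "\<forall>\<^sub>F t in at (0 :: real). cmod (diff_quot u g z t) \<le> C * norm u"
  proof -
    have "((\<lambda>t::real. z + t *\<^sub>R u) \<longlongrightarrow> z + 0 *\<^sub>R u) (at 0)"
      by (intro tendsto_intros)
    then have "\<forall>\<^sub>F t::real in at 0. z + t *\<^sub>R u \<in> ball z 1"
      by (intro topological_tendstoD) auto
    moreover have "\<forall>\<^sub>F t::real in at 0. t \<noteq> 0"
      by (simp add: eventually_at_filter)
    ultimately show ?thesis
    proof eventually_elim
      case t: (elim t)
      then have "cmod (g (z + t *\<^sub>R u) - g z) \<le> C * norm (t *\<^sub>R u)"
        using lipschitz_onD[OF lip, of "z + t *\<^sub>R u" z] by (simp add: dist_norm)
      then show "cmod (diff_quot u g z t) \<le> C * norm u"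
        using t by (simp add: diff_quot_def norm_divide field_simps)
    qed
  qed
  then have "cmod E \<le> C * norm u"
    by (intro tendsto_upperbound[OF tendsto_norm[OF lim]]) auto
  then show ?thesis
    by (simp add: u E_def)
qed

lemma sum_squares_partials_bound:
  assumes "\<And>k. has_partials (single_coord k c) g"
    and "\<And>k. continuous_on UNIV (partial (single_coord k c) g)"
    and "cmod c = 1" and lip: "C-lipschitz_on (ball z 1) g"
  shows "(\<Sum>k<n. (cmod (partial (single_coord k c) g z))\<^sup>2) \<le> 2 * C\<^sup>2"
proof -
  let ?D = "\<lambda>k. partial (single_coord k c) g z"
  have "0 \<le> C"
    using lip by (rule lipschitz_on_nonneg)
  \<comment> \<open>\<open>r k = Re (D k)\<close> in the directional bound gives \<open>x \<le> C * sqrt x\<close> for \<open>x = \<Sum>k<n. (Re (D k))\<^sup>2\<close>\<close>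
  have aux: "x \<le> C\<^sup>2" if "x \<le> C * sqrt x" "0 \<le> x" for x
  proof (cases "x = 0")
    case False
    then have "sqrt x * sqrt x \<le> C * sqrt x" "sqrt x > 0"
      using that by auto
    then have "sqrt x \<le> C"
      by (rule mult_right_le_imp_le)
    then show ?thesis
      using that real_le_lsqrt sqrt_le_D by blast
  qed simp
  note bound = sum_partials_lipschitz_bound[OF assms, where n = n]
  have "(\<Sum>k<n. (Re (?D k))\<^sup>2) \<le> C * sqrt (\<Sum>k<n. (Re (?D k))\<^sup>2)"
    using order_trans[OF complex_Re_le_cmod bound[where r = "\<lambda>k. Re (?D k)"]]
    by (simp add: power2_eq_square)
  then have re: "(\<Sum>k<n. (Re (?D k))\<^sup>2) \<le> C\<^sup>2"
    by (intro aux sum_nonneg) auto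
  have "(\<Sum>k<n. (Im (?D k))\<^sup>2) \<le> C * sqrt (\<Sum>k<n. (Im (?D k))\<^sup>2)"
    using order_trans[OF abs_le_D1[OF abs_Im_le_cmod] bound[where r = "\<lambda>k. Im (?D k)"]]
    by (simp add: power2_eq_square)
  then have im: "(\<Sum>k<n. (Im (?D k))\<^sup>2) \<le> C\<^sup>2"
    by (intro aux sum_nonneg) auto
  \<comment> \<open>The coefficients \<open>r\<close> are real, so real and imaginary parts are
    tested separately; each contributes one \<open>C\<^sup>2\<close>.\<close>
  show ?thesis
    using re im by (simp add: cmod_power2 sum.distrib)
qed

lemma C1F_ell2I:
  assumes g: "g \<in> Ck_ell2 1" and lip: "g \<in> Lip_ell2"
  shows "g \<in> C1F_ell2"
  unfolding C1F_ell2_def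
proof (intro CollectI conjI allI impI g)
  fix S :: "ell2 set" assume "bounded S"
  then obtain r where r: "\<And>z. z \<in> S \<Longrightarrow> norm z \<le> r"
    by (auto simp: bounded_iff)
  \<comment> \<open>The margin 1 puts the unit ball around every point of \<open>S\<close> inside
    the region with constant \<open>C\<close>; the absolute value covers an empty \<open>S\<close>
    with negative \<open>r\<close>.\<close>
  obtain C where C: "C-lipschitz_on (ball 0 (\<bar>r\<bar> + 1)) g" "C > 0"
    using lip by (auto simp: Lip_ell2_def)
  let ?B = "cmod (g 0) + C * \<bar>r\<bar> + 2 * C\<^sup>2"
  have "ennreal (cmod (g z)) + (\<Sum>j. ennreal ((cmod (del j g z))\<^sup>2 + (cmod (delbar j g z))\<^sup>2))
      \<le> ennreal ?B" if "z \<in> S" for z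
  proof -
    have zr: "norm z \<le> \<bar>r\<bar>"
      using r[OF that] by simp
    have "cmod (g z - g 0) \<le> C * norm z"
      using lipschitz_onD[OF C(1), of z 0] zr by (auto simp: dist_norm)
    also have "\<dots> \<le> C * \<bar>r\<bar>"
      using zr C by simp
    finally have gz: "cmod (g z) \<le> cmod (g 0) + C * \<bar>r\<bar>"
      using norm_triangle_ineq2[of "g z" "g 0"] by linarith
    have "ball z 1 \<subseteq> ball 0 (\<bar>r\<bar> + 1)"
    proof
      fix w assume "w \<in> ball z 1"
      then show "w \<in> ball 0 (\<bar>r\<bar> + 1)"
        using zr norm_triangle_sub[of w z] by (simp add: dist_norm norm_minus_commute)
    qed
    then have lz: "C-lipschitz_on (ball z 1) g"
      using C(1) lipschitz_on_subset by blast
    have p: "has_partials v g" "continuous_on UNIV (partial v g)" if "v \<in> coord_dirs" for v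
      using g that by (auto simp: Ck_ell2_Suc_iff simp del: Ck_ell2.simps(2))
    let ?e = "\<lambda>j. (cmod (del j g z))\<^sup>2 + (cmod (delbar j g z))\<^sup>2"
    \<comment> \<open>Parallelogram identity for p - i q and p + i q, where p and q are the two real
      partial derivatives.\<close>
    have e: "?e j = ((cmod (partial (x_dir j) g z))\<^sup>2 + (cmod (partial (y_dir j) g z))\<^sup>2) / 2" for j
      unfolding del_def delbar_def cmod_power2 by (simp add: power2_eq_square field_simps)
    have "(\<Sum>j<n. ?e j) \<le> 2 * C\<^sup>2" for n
    proof -
      have "(\<Sum>j<n. ?e j) = ((\<Sum>j<n. (cmod (partial (x_dir j) g z))\<^sup>2)
          + (\<Sum>j<n. (cmod (partial (y_dir j) g z))\<^sup>2)) / 2"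
        by (simp only: e sum_divide_distrib[symmetric] sum.distrib)
      also have "\<dots> \<le> (2 * C\<^sup>2 + 2 * C\<^sup>2) / 2"
        by (intro divide_right_mono add_mono; (rule sum_squares_partials_bound[OF _ _ _ lz])?)
          (auto simp: p)
      finally show ?thesis
        by (simp only: mult_2[symmetric] nonzero_mult_div_cancel_left[OF numeral_neq_zero])
    qed
    then have "(\<Sum>j<n. ennreal (?e j)) \<le> ennreal (2 * C\<^sup>2)" for n
      by (subst sum_ennreal) (auto intro: ennreal_leI)
    then have "(\<Sum>j. ennreal (?e j)) \<le> ennreal (2 * C\<^sup>2)"
      by (intro suminf_le_const) auto
    then have "ennreal (cmod (g z)) + (\<Sum>j. ennreal (?e j)) \<le>
        ennreal (cmod (g 0) + C * \<bar>r\<bar>) + ennreal (2 * C\<^sup>2)"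
      using gz by (intro add_mono ennreal_leI) auto
    also have "\<dots> = ennreal ?B"
      using C by (subst ennreal_plus[symmetric]) auto
    finally show ?thesis .
  qed
  then have "(SUP z\<in>S. ennreal (cmod (g z)) +
      (\<Sum>j. ennreal ((cmod (del j g z))\<^sup>2 + (cmod (delbar j g z))\<^sup>2))) \<le> ennreal ?B"
    by (intro SUP_least) auto
  also have "\<dots> < \<infinity>"
    by simp
  finally show "(SUP z\<in>S. ennreal (cmod (g z)) +
      (\<Sum>j. ennreal ((cmod (del j g z))\<^sup>2 + (cmod (delbar j g z))\<^sup>2))) < \<infinity>" .
qed


section \<open>Test functions\<close>

text \<open>Vanishing beyond a fixed radius replaces bounded support, so that the same
  \<open>R\<close> serves a function, all its derivatives and their linear combinations.\<close>

definition test_fun_0 :: "real \<Rightarrow> (ell2 \<Rightarrow> complex) set" where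
  "test_fun_0 R = {\<theta>. continuous_on UNIV \<theta> \<and> bounded (range \<theta>) \<and> (\<forall>z. R < norm z \<longrightarrow> \<theta> z = 0)}"

text \<open>Words in the real partial derivatives are allowed in any order, which makes closure
  under differentiation and under multiplication by coordinates a direct induction.\<close>

primrec test_fun :: "real \<Rightarrow> nat \<Rightarrow> (ell2 \<Rightarrow> complex) set" where
  "test_fun R 0 = test_fun_0 R"
| "test_fun R (Suc k) = {\<theta> \<in> test_fun_0 R.
    \<forall>v\<in>coord_dirs. has_partials v \<theta> \<and> partial v \<theta> \<in> test_fun R k}"

definition test_fun_inf :: "real \<Rightarrow> (ell2 \<Rightarrow> complex) set" where
  "test_fun_inf R = (\<Inter>k. test_fun R k)"

lemma test_fun_Suc_subset: "test_fun R (Suc k) \<subseteq> test_fun R k"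
proof (induction k)
  case (Suc k)
  then show ?case by auto
qed auto

lemma test_fun_infD:
  assumes "\<theta> \<in> test_fun_inf R"
  shows "\<theta> \<in> test_fun R k" and "\<theta> \<in> test_fun_0 R"
    and "v \<in> coord_dirs \<Longrightarrow> has_partials v \<theta>"
    and "v \<in> coord_dirs \<Longrightarrow> partial v \<theta> \<in> test_fun_inf R"
proof -
  have *: "\<theta> \<in> test_fun R k" for k
    using assms by (simp add: test_fun_inf_def)
  show "\<theta> \<in> test_fun R k" by (rule *)
  show "\<theta> \<in> test_fun_0 R" using *[of 0] by simp
  show "has_partials v \<theta>" if "v \<in> coord_dirs"
    using *[of "Suc 0"] that by simp
  show "partial v \<theta> \<in> test_fun_inf R" if "v \<in> coord_dirs"
    using *[of "Suc _"] that by (simp add: test_fun_inf_def)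
qed

lemma test_fun_0_bound:
  assumes "\<theta> \<in> test_fun_0 R"
  obtains B where "0 \<le> B" "\<And>z. cmod (\<theta> z) \<le> B"
proof -
  obtain B where B: "\<And>z. cmod (\<theta> z) \<le> B"
    using assms by (auto simp: test_fun_0_def bounded_iff)
  then show ?thesis
    using that[of B] order_trans[OF norm_ge_zero B] by blast
qed

lemma test_fun_0I:
  assumes "continuous_on UNIV \<theta>" "\<And>z. cmod (\<theta> z) \<le> B" "\<And>z. R < norm z \<Longrightarrow> \<theta> z = 0"
  shows "\<theta> \<in> test_fun_0 R"
  using assms by (auto simp: test_fun_0_def bounded_iff)

lemma test_fun_0D:
  assumes "\<theta> \<in> test_fun_0 R"
  shows "continuous_on UNIV \<theta>" and "R < norm z \<Longrightarrow> \<theta> z = 0"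
  using assms by (auto simp: test_fun_0_def)

lemma test_fun_0_lincomb:
  assumes \<theta>: "\<theta> \<in> test_fun_0 R" and \<eta>: "\<eta> \<in> test_fun_0 R"
  shows "(\<lambda>z. c * \<theta> z + d * \<eta> z) \<in> test_fun_0 R"
proof -
  obtain B B' where B: "\<And>z. cmod (\<theta> z) \<le> B" "\<And>z. cmod (\<eta> z) \<le> B'"
    using test_fun_0_bound[OF \<theta>] test_fun_0_bound[OF \<eta>] by metis
  show ?thesis
  proof (rule test_fun_0I)
    fix z
    have "cmod (c * \<theta> z + d * \<eta> z) \<le> cmod c * cmod (\<theta> z) + cmod d * cmod (\<eta> z)"
      by (metis norm_mult norm_triangle_ineq)
    also have "\<dots> \<le> cmod c * B + cmod d * B'"
      by (intro add_mono mult_left_mono B) auto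
    finally show "cmod (c * \<theta> z + d * \<eta> z) \<le> cmod c * B + cmod d * B'" .
  qed (use test_fun_0D[OF \<theta>] test_fun_0D[OF \<eta>] in \<open>auto intro!: continuous_intros\<close>)
qed

lemma test_fun_lincomb:
  "\<theta> \<in> test_fun R k \<Longrightarrow> \<eta> \<in> test_fun R k \<Longrightarrow> (\<lambda>z. c * \<theta> z + d * \<eta> z) \<in> test_fun R k"
  by (induction k arbitrary: \<theta> \<eta>) (auto simp: test_fun_0_lincomb partial_lincomb)

lemma test_fun_inf_lincomb:
  "\<theta> \<in> test_fun_inf R \<Longrightarrow> \<eta> \<in> test_fun_inf R \<Longrightarrow> (\<lambda>z. c * \<theta> z + d * \<eta> z) \<in> test_fun_inf R"
  by (auto simp: test_fun_inf_def test_fun_lincomb)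

lemma coord_scaleR: "coord (r *\<^sub>R z) k = r *\<^sub>R coord z k"
  by (simp add: scaleR_ell2.rep_eq)

lemma partial_mult_coord:
  assumes "has_partials v \<theta>"
  shows "has_partials v (\<lambda>z. of_real (coord z j \<bullet> c) * \<theta> z)"
    and "partial v (\<lambda>z. of_real (coord z j \<bullet> c) * \<theta> z) =
      (\<lambda>z. of_real (coord v j \<bullet> c) * \<theta> z + 1 * (of_real (coord z j \<bullet> c) * partial v \<theta> z))"
proof -
  let ?l = "\<lambda>z. of_real (coord z j \<bullet> c) :: complex"
  have l: "((\<lambda>t. ?l (z + t *\<^sub>R v)) has_vector_derivative ?l v) (at 0)" for z
  proof -
    have "((\<lambda>t. (coord z j \<bullet> c) + t * (coord v j \<bullet> c)) has_real_derivative (coord v j \<bullet> c)) (at 0)"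
      by (auto intro!: derivative_eq_intros)
    from has_vector_derivative_of_real[OF this] show ?thesis
      by (simp add: coord_add coord_scaleR inner_add_left)
  qed
  have "((\<lambda>t. ?l (z + t *\<^sub>R v) * \<theta> (z + t *\<^sub>R v)) has_vector_derivative
      ?l v * \<theta> z + 1 * (?l z * partial v \<theta> z)) (at 0)" for z
    using has_vector_derivative_mult[OF l has_partials_vector_derivative_0[OF assms], of z z]
    by (simp add: algebra_simps)
  note partialsI[of "\<lambda>z. ?l z * \<theta> z", OF this]
  then show "has_partials v (\<lambda>z. ?l z * \<theta> z)"
    and "partial v (\<lambda>z. ?l z * \<theta> z) =
      (\<lambda>z. ?l v * \<theta> z + 1 * (?l z * partial v \<theta> z))"
    by auto
qed

text \<open>A coordinate is unbounded on \<open>ell2\<close>, but where \<theta> is nonzero it is at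
  most \<open>R\<close> in modulus.\<close>

lemma test_fun_0_mult_coord:
  assumes \<theta>: "\<theta> \<in> test_fun_0 R"
  shows "(\<lambda>z. of_real (coord z j \<bullet> c) * \<theta> z) \<in> test_fun_0 R"
proof -
  obtain B where B: "0 \<le> B" "\<And>z. cmod (\<theta> z) \<le> B"
    using test_fun_0_bound[OF \<theta>] by metis
  show ?thesis
  proof (rule test_fun_0I)
    show "continuous_on UNIV (\<lambda>z. of_real (coord z j \<bullet> c) * \<theta> z)"
      by (intro continuous_intros continuous_on_coord test_fun_0D[OF \<theta>])
  next
    fix z
    show "cmod (of_real (coord z j \<bullet> c) * \<theta> z) \<le> \<bar>R\<bar> * cmod c * B"
    proof (cases "norm z \<le> R")
      case True
      have "\<bar>coord z j \<bullet> c\<bar> \<le> cmod (coord z j) * cmod c"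
        by (rule Cauchy_Schwarz_ineq2)
      also have "\<dots> \<le> \<bar>R\<bar> * cmod c"
        using norm_coord_le[of z j] True by (intro mult_right_mono) auto
      finally show ?thesis
        using B by (auto simp: norm_mult intro!: mult_mono)
    next
      case False
      then show ?thesis
        using test_fun_0D(2)[OF \<theta>, of z] B by simp
    qed
  qed (use test_fun_0D[OF \<theta>] in auto)
qed

text \<open>The Leibniz rule returns a multiple of \<theta> itself, which lies in level
  \<open>k\<close> by monotonicity, and a coordinate times \<open>partial v \<theta>\<close>, which
  the induction hypothesis covers.\<close>

lemma test_fun_mult_coord:
  "\<theta> \<in> test_fun R k \<Longrightarrow> (\<lambda>z. of_real (coord z j \<bullet> c) * \<theta> z) \<in> test_fun R k"
proof (induction k arbitrary: \<theta>)
  case 0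
  then show ?case by (simp add: test_fun_0_mult_coord)
next
  case (Suc k)
  have \<theta>: "\<theta> \<in> test_fun R k"
    using Suc.prems test_fun_Suc_subset by blast
  have "partial v (\<lambda>z. of_real (coord z j \<bullet> c) * \<theta> z) \<in> test_fun R k" if "v \<in> coord_dirs" for v
  proof -
    have "has_partials v \<theta>" "partial v \<theta> \<in> test_fun R k"
      using Suc.prems that by auto
    then show ?thesis
      by (simp only: partial_mult_coord) (intro test_fun_lincomb \<theta> Suc.IH)
  qed
  then show ?case
    using Suc.prems by (simp add: test_fun_0_mult_coord partial_mult_coord(1))
qed

text \<open>The region beyond radius \<open>R\<close> is open, so the difference quotients at
  \<open>z\<close> vanish for all small increments.\<close>

lemma partial_eq_0_outside:
  assumes F: "\<And>z. R < norm z \<Longrightarrow> F z = 0" and z: "R < norm z"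
  shows "partial v F z = 0"
proof -
  have "((\<lambda>t::real. norm (z + t *\<^sub>R v)) \<longlongrightarrow> norm (z + 0 *\<^sub>R v)) (at 0)"
    by (intro tendsto_intros)
  then have "\<forall>\<^sub>F t::real in at 0. R < norm (z + t *\<^sub>R v)"
    using z by (intro order_tendstoD) auto
  then have "\<forall>\<^sub>F t in at 0. diff_quot v F z t = 0"
    by eventually_elim (simp add: diff_quot_def F z)
  then show ?thesis
    unfolding partial_def by (intro tendsto_Lim tendsto_eventually) auto
qed

text \<open>The induction on \<open>k\<close> runs over the whole \<open>derivative_span\<close>,
  since a partial derivative leaves \<theta> but not the span. Boundedness of the generators is
  given; vanishing beyond \<open>R\<close> is inherited through each Wirtinger operator.\<close>

lemma Cinf0_ell2_subset_test_fun_inf: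
  assumes "\<theta> \<in> Cinf0_ell2"
  obtains R where "0 \<le> R" "\<theta> \<in> test_fun_inf R"
proof -
  have \<theta>: "\<theta> \<in> Cinf_ell2" and bs: "bounded (closure {z. \<theta> z \<noteq> 0})"
    and bd: "\<And>\<alpha> \<beta>. \<alpha> \<in> multi_index \<Longrightarrow> \<beta> \<in> multi_index \<Longrightarrow>
      bounded (range (iter_op del \<alpha> (iter_op delbar \<beta> \<theta>)))"
    using assms by (auto simp: Cinf0_ell2_def)
  have "bounded {z. \<theta> z \<noteq> 0}"
    using bs closure_subset bounded_subset by blast
  then obtain R where R: "0 < R" "\<And>z. \<theta> z \<noteq> 0 \<Longrightarrow> norm z \<le> R"
    by (auto simp: bounded_pos)
  define A where "A = {F :: ell2 \<Rightarrow> complex. \<forall>z. R < norm z \<longrightarrow> F z = 0}"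
  have "wirt s j F \<in> A" if "F \<in> A" for s j F
  proof -
    have "partial v F z = 0" if "R < norm z" for v z
      using \<open>F \<in> A\<close> that by (intro partial_eq_0_outside[of R]) (auto simp: A_def)
    then show ?thesis
      by (simp add: A_def wirt_def)
  qed
  then have del_A: "del j F \<in> A" "delbar j F \<in> A" if "F \<in> A" for j F
    using that by (auto simp: del_eq_wirt delbar_eq_wirt)
  have \<theta>_A: "\<theta> \<in> A"
    using R by (force simp: A_def)
  have "F \<in> test_fun_0 R" if "F \<in> derivative_span \<theta>" for F
  proof -
    have "bounded (range F) \<and> F \<in> A"
      using that
    proof induction
      case (base \<alpha> \<beta>)
      then show ?case
        by (intro conjI bd iter_op_induct[of _ A] del_A \<theta>_A)
    next
      case (lincomb F G c d)
      then have "bounded (range F)" "bounded (range G)"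
        by auto
      then obtain B B' where B: "\<And>z. cmod (F z) \<le> B" "\<And>z. cmod (G z) \<le> B'"
        unfolding bounded_iff by blast
      have "cmod (c * F z + d * G z) \<le> cmod c * B + cmod d * B'" for z
        by (rule order_trans[OF norm_triangle_ineq])
          (simp only: norm_mult, intro add_mono mult_left_mono B norm_ge_zero)
      then have "bounded (range (\<lambda>z. c * F z + d * G z))"
        unfolding bounded_iff by blast
      then show ?case
        using lincomb.IH by (simp add: A_def)
    qed
    then show ?thesis
      using wirt_derivative_span[OF \<theta> that] Cinf_ell2D(2) by (simp add: test_fun_0_def A_def)
  qed
  note span_0 = this
  have "F \<in> test_fun R k" if "F \<in> derivative_span \<theta>" for F k
    using that
  proof (induction k arbitrary: F)
    case 0
    then show ?case
      by (simp add: span_0)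
  next
    case (Suc k)
    have "F \<in> Cinf_ell2"
      using wirt_derivative_span[OF \<theta> Suc.prems] by blast
    then have "has_partials v F \<and> partial v F \<in> test_fun R k" if "v \<in> coord_dirs" for v
      using Cinf_ell2D(3) Suc.IH partial_derivative_span[OF \<theta> Suc.prems that] that by blast
    then show ?case
      using span_0[OF Suc.prems] by simp
  qed
  then have "\<theta> \<in> test_fun_inf R"
    unfolding test_fun_inf_def using self_in_derivative_span by blast
  then show ?thesis
    using that R(1) less_imp_le by blast
qed


section \<open>Mollification\<close>

text \<open>Up to sign, the formal adjoint with respect to \<open>P\<close> of differentiation along
  \<open>single_coord j c\<close>: this is Gaussian integration by parts.\<close>

definition gaussian_deriv ::
    "(nat \<Rightarrow> real) \<Rightarrow> nat \<Rightarrow> complex \<Rightarrow> (ell2 \<Rightarrow> complex) \<Rightarrow> ell2 \<Rightarrow> complex" where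
  "gaussian_deriv a j c \<theta> = (\<lambda>\<zeta>. 1 * partial (single_coord j c) \<theta> \<zeta>
    + of_real (- 1 / (a j)\<^sup>2) * (of_real (coord \<zeta> j \<bullet> c) * \<theta> \<zeta>))"

lemma gaussian_deriv_test_fun_inf:
  assumes "\<theta> \<in> test_fun_inf R" "single_coord j c \<in> coord_dirs"
  shows "gaussian_deriv a j c \<theta> \<in> test_fun_inf R"
proof -
  have "(\<lambda>\<zeta>. of_real (coord \<zeta> j \<bullet> c) * \<theta> \<zeta>) \<in> test_fun_inf R"
    using assms(1) test_fun_mult_coord by (simp add: test_fun_inf_def)
  then show ?thesis
    unfolding gaussian_deriv_def by (intro test_fun_inf_lincomb test_fun_infD(4) assms)
qed

text \<open>The factor that \<theta> becomes once the change of variables has freed f of the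
  increment. In \<open>s\<close> this is a one-parameter group of operators with generator
  \<open>gaussian_deriv a j c\<close>.\<close>

definition weighted_shift ::
    "(nat \<Rightarrow> real) \<Rightarrow> nat \<Rightarrow> complex \<Rightarrow> (ell2 \<Rightarrow> complex) \<Rightarrow> real \<Rightarrow> ell2 \<Rightarrow> complex" where
  "weighted_shift a j c \<theta> s \<zeta> =
    shift_density (a j) (s *\<^sub>R c) (coord \<zeta> j) *\<^sub>R \<theta> (\<zeta> + s *\<^sub>R single_coord j c)"

lemma weighted_shift_0 [simp]: "weighted_shift a j c \<theta> 0 \<zeta> = \<theta> \<zeta>"
  by (simp add: weighted_shift_def shift_density_def)

text \<open>The quadratic term of the exponent turns the linear factor into its value at the shifted
  point \<open>x + s *\<^sub>R c\<close>. This is what makes the derivative of a weighted shift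
  again a weighted shift.\<close>

lemma shift_density_has_derivative:
  assumes "0 < \<sigma>"
  shows "((\<lambda>s. shift_density \<sigma> (s *\<^sub>R c) x) has_real_derivative
    shift_density \<sigma> (s *\<^sub>R c) x * (- ((x + s *\<^sub>R c) \<bullet> c) / \<sigma>\<^sup>2)) (at s)"
proof -
  have eq: "shift_density \<sigma> (s *\<^sub>R c) x = exp (- (2 * (s * (x \<bullet> c)) + s\<^sup>2 * (cmod c)\<^sup>2) / (2 * \<sigma>\<^sup>2))"
    for s
    by (simp add: shift_density_def power_mult_distrib)
  have in_eq: "(x + s *\<^sub>R c) \<bullet> c = x \<bullet> c + s * (cmod c)\<^sup>2"
    by (simp only: inner_add_left inner_scaleR_left power2_norm_eq_inner)
  have "((\<lambda>s. - (2 * (s * (x \<bullet> c)) + s\<^sup>2 * (cmod c)\<^sup>2)) has_real_derivative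
      - (2 * (x \<bullet> c) + 2 * s * (cmod c)\<^sup>2)) (at s)"
    by (auto intro!: derivative_eq_intros)
  from DERIV_chain2[OF DERIV_exp DERIV_cdivide[OF this, of "2 * \<sigma>\<^sup>2"]]
  have "((\<lambda>s. exp (- (2 * (s * (x \<bullet> c)) + s\<^sup>2 * (cmod c)\<^sup>2) / (2 * \<sigma>\<^sup>2))) has_real_derivative
      exp (- (2 * (s * (x \<bullet> c)) + s\<^sup>2 * (cmod c)\<^sup>2) / (2 * \<sigma>\<^sup>2))
        * (- (2 * (x \<bullet> c) + 2 * s * (cmod c)\<^sup>2) / (2 * \<sigma>\<^sup>2))) (at s)" .
  moreover have "- (2 * (x \<bullet> c) + 2 * s * (cmod c)\<^sup>2) / (2 * \<sigma>\<^sup>2) =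
      - (x \<bullet> c + s * (cmod c)\<^sup>2) / \<sigma>\<^sup>2"
    using assms by (simp add: field_simps)
  ultimately show ?thesis
    unfolding eq in_eq by (simp only:)
qed

lemma weighted_shift_has_derivative:
  assumes "0 < a j" and \<theta>: "has_partials (single_coord j c) \<theta>"
  shows "((\<lambda>s. weighted_shift a j c \<theta> s \<zeta>) has_vector_derivative
    weighted_shift a j c (gaussian_deriv a j c \<theta>) s \<zeta>) (at s)"
proof -
  let ?v = "single_coord j c"
  have alg: "r *\<^sub>R p + (r * (- b / A)) *\<^sub>R q =
      r *\<^sub>R (1 * p + of_real (- 1 / A) * (of_real b * q))" for r b A :: real and p q :: complex
    by (simp add: scaleR_conv_of_real algebra_simps)
  have co: "coord (\<zeta> + s *\<^sub>R ?v) j = coord \<zeta> j + s *\<^sub>R c"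
    by (simp add: coord_add coord_scaleR coord_single_coord)
  have "((\<lambda>s. shift_density (a j) (s *\<^sub>R c) (coord \<zeta> j) *\<^sub>R \<theta> (\<zeta> + s *\<^sub>R ?v)) has_vector_derivative
      shift_density (a j) (s *\<^sub>R c) (coord \<zeta> j) *\<^sub>R partial ?v \<theta> (\<zeta> + s *\<^sub>R ?v)
      + (shift_density (a j) (s *\<^sub>R c) (coord \<zeta> j) * (- ((coord \<zeta> j + s *\<^sub>R c) \<bullet> c) / (a j)\<^sup>2))
        *\<^sub>R \<theta> (\<zeta> + s *\<^sub>R ?v)) (at s)"
    by (intro has_vector_derivative_scaleR shift_density_has_derivative assms
        has_partials_vector_derivative)
  also have "shift_density (a j) (s *\<^sub>R c) (coord \<zeta> j) *\<^sub>R partial ?v \<theta> (\<zeta> + s *\<^sub>R ?v)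
      + (shift_density (a j) (s *\<^sub>R c) (coord \<zeta> j) * (- ((coord \<zeta> j + s *\<^sub>R c) \<bullet> c) / (a j)\<^sup>2))
        *\<^sub>R \<theta> (\<zeta> + s *\<^sub>R ?v) = weighted_shift a j c (gaussian_deriv a j c \<theta>) s \<zeta>"
    unfolding weighted_shift_def gaussian_deriv_def co by (rule alg)
  finally show ?thesis
    unfolding weighted_shift_def .
qed

lemma weighted_shift_eq_0:
  assumes \<theta>: "\<theta> \<in> test_fun_0 R" and s: "\<bar>s\<bar> \<le> 1" and \<zeta>: "R + cmod c < norm \<zeta>"
  shows "weighted_shift a j c \<theta> s \<zeta> = 0"
proof -
  let ?v = "s *\<^sub>R single_coord j c"
  have "norm \<zeta> \<le> norm (\<zeta> + ?v) + norm ?v"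
    using norm_triangle_ineq4[of "\<zeta> + ?v" ?v] by simp
  moreover have "norm ?v \<le> 1 * cmod c"
    unfolding norm_scaleR norm_single_coord using s by (intro mult_right_mono) auto
  ultimately show ?thesis
    using \<zeta> test_fun_0D(2)[OF \<theta>] by (simp add: weighted_shift_def)
qed

lemma weighted_shift_bound:
  assumes \<theta>: "\<theta> \<in> test_fun_0 R" and "0 \<le> R" "0 < a j"
  obtains B where "0 \<le> B" "\<And>s \<zeta>. \<bar>s\<bar> \<le> 1 \<Longrightarrow> cmod (weighted_shift a j c \<theta> s \<zeta>) \<le> B"
proof -
  obtain B where B: "0 \<le> B" "\<And>z. cmod (\<theta> z) \<le> B"
    using test_fun_0_bound[OF \<theta>] by blast
  \<comment> \<open>The density is unbounded in the coordinate, but the shifted function lives where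
    the norm is at most \<open>R + cmod c\<close>. There Cauchy-Schwarz bounds the linear term of
    the exponent, and the quadratic term only helps.\<close>
  define E where "E = exp ((R + cmod c) * cmod c / (a j)\<^sup>2)"
  have "cmod (weighted_shift a j c \<theta> s \<zeta>) \<le> E * B" if s: "\<bar>s\<bar> \<le> 1" for s \<zeta>
  proof (cases "norm \<zeta> \<le> R + cmod c")
    case True
    let ?x = "coord \<zeta> j"
    have "- (?x \<bullet> (s *\<^sub>R c)) \<le> cmod ?x * cmod (s *\<^sub>R c)"
      using Cauchy_Schwarz_ineq2[of ?x "s *\<^sub>R c"] by linarith
    also have "\<dots> \<le> (R + cmod c) * cmod c"
      using True norm_coord_le[of \<zeta> j] s \<open>0 \<le> R\<close> mult_right_mono[OF s, of "cmod c"]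
      by (intro mult_mono) auto
    finally have "- (2 * (?x \<bullet> (s *\<^sub>R c)) + (cmod (s *\<^sub>R c))\<^sup>2) \<le> 2 * ((R + cmod c) * cmod c)"
      using zero_le_power2[of "cmod (s *\<^sub>R c)"] by linarith
    then have "- (2 * (?x \<bullet> (s *\<^sub>R c)) + (cmod (s *\<^sub>R c))\<^sup>2) / (2 * (a j)\<^sup>2)
        \<le> 2 * ((R + cmod c) * cmod c) / (2 * (a j)\<^sup>2)"
      by (rule divide_right_mono) simp
    then have "shift_density (a j) (s *\<^sub>R c) ?x \<le> E"
      by (simp add: shift_density_def E_def)
    then show ?thesis
      unfolding weighted_shift_def norm_scaleR abs_of_pos[OF shift_density_pos]
      by (intro mult_mono B) (auto simp: E_def)
  next
    case False
    then show ?thesis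
      using weighted_shift_eq_0[OF \<theta> s, of c \<zeta> a j] B by (simp add: E_def)
  qed
  moreover have "0 \<le> E * B"
    using B by (simp add: E_def)
  ultimately show ?thesis
    using that by blast
qed

text \<open>The \<open>s\<close>-derivative of \<open>weighted_shift a j c \<theta>\<close> is the weighted shift of \<open>gaussian_deriv a j c \<theta>\<close>,
  so two applications give a second order bound uniform in \<open>\<zeta>\<close>, and no dominated convergence is needed to
  differentiate under the integral.\<close>

lemma weighted_shift_second_order:
  assumes \<theta>: "\<theta> \<in> test_fun_inf R" and R: "0 \<le> R" "0 < a j" and c: "single_coord j c \<in> coord_dirs"
  obtains B where "0 \<le> B" "\<And>s \<zeta>. \<bar>s\<bar> \<le> 1 \<Longrightarrow>
    cmod (weighted_shift a j c \<theta> s \<zeta> - \<theta> \<zeta> - s *\<^sub>R gaussian_deriv a j c \<theta> \<zeta>) \<le> B * s\<^sup>2"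
proof -
  let ?T = "gaussian_deriv a j c"
  have T: "?T \<theta> \<in> test_fun_inf R" "?T (?T \<theta>) \<in> test_fun_inf R"
    by (intro gaussian_deriv_test_fun_inf \<theta> c)+
  obtain B where B: "0 \<le> B" "\<And>s \<zeta>. \<bar>s\<bar> \<le> 1 \<Longrightarrow> cmod (weighted_shift a j c (?T (?T \<theta>)) s \<zeta>) \<le> B"
    using weighted_shift_bound[of "?T (?T \<theta>)" R a j c] test_fun_infD(2)[OF T(2)] R by blast
  have "cmod (weighted_shift a j c \<theta> s \<zeta> - \<theta> \<zeta> - s *\<^sub>R ?T \<theta> \<zeta>) \<le> B * s\<^sup>2" if s: "\<bar>s\<bar> \<le> 1" for s \<zeta>
  proof -
    have first: "cmod (weighted_shift a j c (?T \<theta>) r \<zeta> - ?T \<theta> \<zeta>) \<le> \<bar>s\<bar> * B" if r: "\<bar>r\<bar> \<le> \<bar>s\<bar>" for r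
    proof -
      have "cmod (weighted_shift a j c (?T \<theta>) r \<zeta> - weighted_shift a j c (?T \<theta>) 0 \<zeta> - r *\<^sub>R 0) \<le> \<bar>r\<bar> * B"
      proof (rule vector_derivative_increment_bound)
        fix q assume "\<bar>q\<bar> \<le> \<bar>r\<bar>"
        then show "cmod (weighted_shift a j c (?T (?T \<theta>)) q \<zeta> - 0) \<le> B"
          using B(2)[of q] r s by simp
      qed (intro weighted_shift_has_derivative R test_fun_infD(3)[OF T(1)] c)
      also have "\<dots> \<le> \<bar>s\<bar> * B"
        using r B by (intro mult_right_mono)
      finally show ?thesis by simp
    qed
    have "cmod (weighted_shift a j c \<theta> s \<zeta> - weighted_shift a j c \<theta> 0 \<zeta> - s *\<^sub>R ?T \<theta> \<zeta>) \<le> \<bar>s\<bar> * (\<bar>s\<bar> * B)"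
      by (rule vector_derivative_increment_bound[OF weighted_shift_has_derivative[where a = a and j = j, OF R(2)] first])
        (intro test_fun_infD(3)[OF \<theta>] c)
    then show ?thesis
      by (simp add: power2_eq_square algebra_simps abs_mult_self_eq)
  qed
  with B that show ?thesis by blast
qed

lemma has_vector_derivative_quadratic:
  fixes g :: "real \<Rightarrow> 'a::real_normed_vector"
  assumes "0 < d" and B: "\<And>t. \<bar>t\<bar> \<le> d \<Longrightarrow> norm (g t - g 0 - t *\<^sub>R D) \<le> B * t\<^sup>2"
  shows "(g has_vector_derivative D) (at 0)"
  unfolding has_vector_derivative_def has_derivative_at_alt
proof (intro conjI allI impI bounded_linear_scaleR_left)
  fix e :: real assume "0 < e"
  have "0 \<le> B * d\<^sup>2"
    using B[of d] \<open>0 < d\<close> order_trans[OF norm_ge_zero] by auto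
  then have "0 \<le> B"
    using \<open>0 < d\<close> by (simp add: zero_le_mult_iff)
  show "\<exists>\<delta>>0. \<forall>t. norm (t - 0) < \<delta> \<longrightarrow> norm (g t - g 0 - (t - 0) *\<^sub>R D) \<le> e * norm (t - 0)"
  proof (intro exI[of _ "min d (e / (B + 1))"] conjI allI impI)
    fix t :: real assume t: "norm (t - 0) < min d (e / (B + 1))"
    then have "\<bar>t\<bar> * (B + 1) < e"
      using \<open>0 \<le> B\<close> by (simp add: field_simps)
    then have "B * \<bar>t\<bar> \<le> e"
      by (simp add: algebra_simps)
    from mult_right_mono[OF this, of "\<bar>t\<bar>"] have "B * t\<^sup>2 \<le> e * \<bar>t\<bar>"
      by (simp add: power2_eq_square abs_mult_self_eq mult.assoc)
    then show "norm (g t - g 0 - (t - 0) *\<^sub>R D) \<le> e * norm (t - 0)"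
      using B[of t] t by simp
  qed (use \<open>0 < d\<close> \<open>0 < e\<close> \<open>0 \<le> B\<close> in auto)
qed

lemma Lip_ell2_bound:
  assumes "f \<in> Lip_ell2"
  obtains C where "0 < C" "C-lipschitz_on (cball 0 r) f" "\<And>z. norm z \<le> r \<Longrightarrow> cmod (f z) \<le> cmod (f 0) + C * r"
proof -
  obtain C where C: "C > 0" "C-lipschitz_on (cball 0 r) f"
    using assms by (auto simp: Lip_ell2_def)
  have "cmod (f z) \<le> cmod (f 0) + C * r" if "norm z \<le> r" for z
  proof -
    have "0 \<le> r"
      using that norm_ge_zero order_trans by blast
    then have "cmod (f z - f 0) \<le> C * norm z"
      using lipschitz_onD[OF C(2), of z 0] that by (simp add: dist_norm)
    also have "\<dots> \<le> C * r"
      using that C by simp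
    finally show ?thesis
      using norm_triangle_ineq2[of "f z" "f 0"] by linarith
  qed
  with C that show ?thesis by blast
qed

lemma continuous_on_Lip_ell2:
  assumes "f \<in> Lip_ell2"
  shows "continuous_on UNIV f"
proof -
  have "continuous_on (\<Union>r::real. ball 0 r) f"
  proof (rule continuous_on_open_UN)
    fix r :: real
    obtain C where "C-lipschitz_on (ball 0 r) f"
      using assms by (auto simp: Lip_ell2_def)
    then show "continuous_on (ball 0 r) f"
      by (rule lipschitz_on_continuous_on)
  qed auto
  moreover have "(\<Union>r::real. ball (0 :: ell2) r) = UNIV"
    by (auto intro: gt_ex)
  ultimately show ?thesis by simp
qed

section \<open>The mollification as an operator on test functions\<close>

text \<open>f and \<epsilon> are fixed while the test function varies, because differentiation acts
  on the test function alone.\<close>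

locale mollifier =
  fixes a :: "nat \<Rightarrow> real" and f :: "ell2 \<Rightarrow> complex" and \<epsilon> :: real
  assumes a_pos: "\<And>i. 0 < a i" and f_Lip: "f \<in> Lip_ell2" and eps_pos: "0 < \<epsilon>"
begin

definition conv :: "(ell2 \<Rightarrow> complex) \<Rightarrow> ell2 \<Rightarrow> complex" where
  "conv \<theta> z = (\<integral>\<zeta>. f (z - \<epsilon> *\<^sub>R \<zeta>) * \<theta> \<zeta> \<partial>P a)"

abbreviation mass :: real where "mass \<equiv> measure (P a) UNIV"

sublocale finite_measure "P a"
  by (rule finite_measure_P[OF a_pos])

lemma bounded_integral:
  fixes g :: "ell2 \<Rightarrow> complex"
  assumes g: "continuous_on UNIV g" and B: "\<And>\<zeta>. cmod (g \<zeta>) \<le> B"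
  shows "integrable (P a) g" and "cmod (\<integral>\<zeta>. g \<zeta> \<partial>P a) \<le> B * mass"
proof -
  have "g \<in> borel_measurable (P a)"
    using borel_measurable_continuous_onI[OF g] measurable_cong_sets[OF sets_P refl] by blast
  then show int: "integrable (P a) g"
    by (rule integrable_const_bound[OF AE_I2[OF B]])
  have "cmod (\<integral>\<zeta>. g \<zeta> \<partial>P a) \<le> (\<integral>\<zeta>. cmod (g \<zeta>) \<partial>P a)"
    by (rule integral_norm_bound)
  also have "\<dots> \<le> (\<integral>\<zeta>. B \<partial>P a)"
    using int B by (intro integral_mono) auto
  finally show "cmod (\<integral>\<zeta>. g \<zeta> \<partial>P a) \<le> B * mass"
    by (simp add: mult.commute)
qed

lemma continuous_on_f_affine: "continuous_on UNIV (\<lambda>\<zeta>. f (z - \<epsilon> *\<^sub>R \<zeta>))"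
  by (rule continuous_on_compose2[OF continuous_on_Lip_ell2[OF f_Lip]]) (auto intro!: continuous_intros)

lemma norm_affine_le: "norm z \<le> r \<Longrightarrow> norm \<zeta> \<le> R \<Longrightarrow> norm (z - \<epsilon> *\<^sub>R \<zeta>) \<le> r + \<epsilon> * R"
  using norm_triangle_ineq4[of z "\<epsilon> *\<^sub>R \<zeta>"] eps_pos
  by (auto intro!: add_mono mult_left_mono elim!: order_trans)

text \<open>Lets f, bounded only on bounded sets, be estimated on the ball where the other factor
  can be nonzero.\<close>

lemma product_bound:
  assumes g0: "\<And>\<zeta>. R < norm \<zeta> \<Longrightarrow> g \<zeta> = 0" and M: "\<And>\<zeta>. norm \<zeta> \<le> R \<Longrightarrow> cmod (h \<zeta>) \<le> M"
    and B: "\<And>\<zeta>. cmod (g \<zeta>) \<le> B" and "0 \<le> M"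
  shows "cmod (h \<zeta> * g \<zeta>) \<le> M * B"
proof (cases "norm \<zeta> \<le> R")
  case True
  then show ?thesis
    unfolding norm_mult using \<open>0 \<le> M\<close> by (intro mult_mono M B) auto
next
  case False
  have "0 \<le> B"
    using order_trans[OF norm_ge_zero B] .
  then show ?thesis
    using False g0[of \<zeta>] \<open>0 \<le> M\<close> by simp
qed

lemma f_affine_bound:
  obtains M where "0 \<le> M" "\<And>\<zeta>. norm \<zeta> \<le> R \<Longrightarrow> cmod (f (z - \<epsilon> *\<^sub>R \<zeta>)) \<le> M"
proof -
  obtain C where C: "0 < C"
    "\<And>y. norm y \<le> norm z + \<epsilon> * R \<Longrightarrow> cmod (f y) \<le> cmod (f 0) + C * (norm z + \<epsilon> * R)"
    using Lip_ell2_bound[OF f_Lip] by blast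
  show ?thesis
    by (rule that[of "\<bar>cmod (f 0) + C * (norm z + \<epsilon> * R)\<bar>"])
      (auto intro!: order_trans[OF C(2)[OF norm_affine_le]])
qed

lemma integrable_product:
  assumes g: "continuous_on UNIV g" "\<And>\<zeta>. R < norm \<zeta> \<Longrightarrow> g \<zeta> = 0" "\<And>\<zeta>. cmod (g \<zeta>) \<le> B"
  shows "integrable (P a) (\<lambda>\<zeta>. f (z - \<epsilon> *\<^sub>R \<zeta>) * g \<zeta>)"
proof -
  obtain M where "0 \<le> M" "\<And>\<zeta>. norm \<zeta> \<le> R \<Longrightarrow> cmod (f (z - \<epsilon> *\<^sub>R \<zeta>)) \<le> M"
    using f_affine_bound by blast
  then show ?thesis
    by (intro bounded_integral(1)[where B = "M * B"] continuous_on_mult continuous_on_f_affine g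
        product_bound[where g = g, OF g(2) _ g(3)]) auto
qed

lemma integrable_conv:
  assumes \<theta>: "\<theta> \<in> test_fun_0 R"
  shows "integrable (P a) (\<lambda>\<zeta>. f (z - \<epsilon> *\<^sub>R \<zeta>) * \<theta> \<zeta>)"
proof -
  obtain B where B: "\<And>\<zeta>. cmod (\<theta> \<zeta>) \<le> B"
    using test_fun_0_bound[OF \<theta>] by blast
  show ?thesis
    by (rule integrable_product[OF test_fun_0D[OF \<theta>] B])
qed

lemma conv_lincomb:
  assumes "\<theta> \<in> test_fun_0 R" "\<eta> \<in> test_fun_0 R"
  shows "conv (\<lambda>\<zeta>. c * \<theta> \<zeta> + d * \<eta> \<zeta>) = (\<lambda>z. c * conv \<theta> z + d * conv \<eta> z)"
proof
  fix z
  have "conv (\<lambda>\<zeta>. c * \<theta> \<zeta> + d * \<eta> \<zeta>) z =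
      (\<integral>\<zeta>. c * (f (z - \<epsilon> *\<^sub>R \<zeta>) * \<theta> \<zeta>) + d * (f (z - \<epsilon> *\<^sub>R \<zeta>) * \<eta> \<zeta>) \<partial>P a)"
    unfolding conv_def by (simp add: algebra_simps)
  then show "conv (\<lambda>\<zeta>. c * \<theta> \<zeta> + d * \<eta> \<zeta>) z = c * conv \<theta> z + d * conv \<eta> z"
    unfolding conv_def by (simp add: integrable_conv[OF assms(1)] integrable_conv[OF assms(2)])
qed

lemma conv_Lip:
  assumes \<theta>: "\<theta> \<in> test_fun_0 R" and "0 \<le> R"
  shows "conv \<theta> \<in> Lip_ell2"
  unfolding Lip_ell2_def
proof (intro CollectI allI impI)
  fix S :: "ell2 set" assume "bounded S"
  then obtain r where r: "\<And>z. z \<in> S \<Longrightarrow> norm z \<le> r"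
    by (auto simp: bounded_iff)
  \<comment> \<open>For \<open>z\<close> in \<open>S\<close> and \<zeta> of norm at most
    \<open>R\<close>, all arguments \<open>z - \<epsilon> *\<^sub>R \<zeta>\<close> lie in this
    ball, so one constant serves the whole integral.\<close>
  obtain C where C: "0 < C" "C-lipschitz_on (cball 0 (r + \<epsilon> * R)) f"
    using Lip_ell2_bound[OF f_Lip] by blast
  obtain B where B: "0 \<le> B" "\<And>\<zeta>. cmod (\<theta> \<zeta>) \<le> B"
    using test_fun_0_bound[OF \<theta>] by blast
  have lip: "cmod (conv \<theta> z - conv \<theta> w) \<le> C * norm (z - w) * B * mass" if "z \<in> S" "w \<in> S" for z w
  proof -
    have "conv \<theta> z - conv \<theta> w = (\<integral>\<zeta>. (f (z - \<epsilon> *\<^sub>R \<zeta>) - f (w - \<epsilon> *\<^sub>R \<zeta>)) * \<theta> \<zeta> \<partial>P a)"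
      unfolding conv_def left_diff_distrib
      by (simp add: integrable_conv[OF \<theta>])
    also have "cmod \<dots> \<le> C * norm (z - w) * B * mass"
    proof (rule bounded_integral(2))
      show "continuous_on UNIV (\<lambda>\<zeta>. (f (z - \<epsilon> *\<^sub>R \<zeta>) - f (w - \<epsilon> *\<^sub>R \<zeta>)) * \<theta> \<zeta>)"
        by (intro continuous_on_mult continuous_on_diff continuous_on_f_affine test_fun_0D[OF \<theta>])
      show "cmod ((f (z - \<epsilon> *\<^sub>R \<zeta>) - f (w - \<epsilon> *\<^sub>R \<zeta>)) * \<theta> \<zeta>) \<le> C * norm (z - w) * B" for \<zeta>
      proof (rule product_bound[OF test_fun_0D(2)[OF \<theta>] _ B(2)])
        fix \<zeta> :: ell2 assume "norm \<zeta> \<le> R"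
        then have "z - \<epsilon> *\<^sub>R \<zeta> \<in> cball 0 (r + \<epsilon> * R)" "w - \<epsilon> *\<^sub>R \<zeta> \<in> cball 0 (r + \<epsilon> * R)"
          using norm_affine_le[OF r] that by (simp_all add: mem_cball_0)
        from lipschitz_onD[OF C(2) this]
        show "cmod (f (z - \<epsilon> *\<^sub>R \<zeta>) - f (w - \<epsilon> *\<^sub>R \<zeta>)) \<le> C * norm (z - w)"
          by (simp add: dist_norm)
      qed (use C in auto)
    qed
    finally show ?thesis .
  qed
  \<comment> \<open>The added 1 supplies the strictly positive constant demanded by
    \<open>Lip_ell2\<close> even if \<open>B * mass\<close> is 0.\<close>
  have "cmod (conv \<theta> z - conv \<theta> w) \<le> (C * B * mass + 1) * norm (z - w)" if "z \<in> S" "w \<in> S" for z w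
    using add_increasing[OF norm_ge_zero[of "z - w"] lip[OF that]] by (simp add: algebra_simps)
  moreover have "0 < C * B * mass + 1"
    using C B by (intro add_nonneg_pos) auto
  ultimately show "\<exists>K>0. K-lipschitz_on S (conv \<theta>)"
    by (intro exI[of _ "C * B * mass + 1"]) (auto simp: lipschitz_on_def dist_norm)
qed

text \<open>Moving \<open>z\<close> by \<epsilon> s along the direction has the same effect inside f
  as moving \<zeta> by -s, which is the change of variables that the Gaussian shift formula
  handles.\<close>

lemma conv_shift:
  assumes \<theta>: "\<theta> \<in> test_fun_0 R"
  shows "conv \<theta> (z + (\<epsilon> * s) *\<^sub>R single_coord j c) =
    (\<integral>\<zeta>. f (z - \<epsilon> *\<^sub>R \<zeta>) * weighted_shift a j c \<theta> s \<zeta> \<partial>P a)"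
proof -
  let ?v = "s *\<^sub>R single_coord j c"
  have v: "single_coord j (s *\<^sub>R c) = ?v"
    by (rule ell2_eqI) (simp add: coord_scaleR coord_single_coord)
  define h where "h \<zeta> = f (z - \<epsilon> *\<^sub>R \<zeta>) * \<theta> (\<zeta> + ?v)" for \<zeta>
  have "continuous_on UNIV h"
    unfolding h_def
    by (intro continuous_on_mult continuous_on_f_affine
        continuous_on_compose2[OF test_fun_0D(1)[OF \<theta>]] continuous_intros) auto
  then have h: "h \<in> borel_measurable borel"
    by (rule borel_measurable_continuous_onI)
  have "conv \<theta> (z + (\<epsilon> * s) *\<^sub>R single_coord j c) = (\<integral>\<zeta>. h (\<zeta> - single_coord j (s *\<^sub>R c)) \<partial>P a)"
    unfolding conv_def h_def v by (simp add: algebra_simps)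
  also have "\<dots> = (\<integral>\<zeta>. shift_density (a j) (s *\<^sub>R c) (coord \<zeta> j) *\<^sub>R h \<zeta> \<partial>P a)"
    by (rule integral_P_shift[OF a_pos h])
  finally show ?thesis
    by (simp add: h_def weighted_shift_def)
qed

lemma continuous_on_weighted_shift:
  assumes \<theta>: "continuous_on UNIV \<theta>"
  shows "continuous_on UNIV (weighted_shift a j c \<theta> s)"
proof -
  have "continuous_on UNIV (\<lambda>\<zeta>. shift_density (a j) (s *\<^sub>R c) (coord \<zeta> j))"
    unfolding shift_density_def
    by (intro continuous_on_exp continuous_on_divide continuous_on_minus continuous_on_add
        continuous_on_mult_left continuous_on_inner continuous_on_const continuous_on_coord)
      (use a_pos[of j] in simp)
  moreover have "continuous_on UNIV (\<lambda>\<zeta>. \<theta> (\<zeta> + s *\<^sub>R single_coord j c))"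
    by (rule continuous_on_compose2[OF \<theta>]) (auto intro!: continuous_on_add)
  ultimately show ?thesis
    unfolding weighted_shift_def by (rule continuous_on_scaleR)
qed

lemma conv_has_vector_derivative:
  assumes \<theta>: "\<theta> \<in> test_fun_inf R" and R: "0 \<le> R" and c: "single_coord j c \<in> coord_dirs"
  shows "((\<lambda>t. conv \<theta> (z + t *\<^sub>R single_coord j c)) has_vector_derivative
    of_real (1 / \<epsilon>) * conv (gaussian_deriv a j c \<theta>) z) (at 0)"
proof -
  let ?T = "gaussian_deriv a j c \<theta>" and ?W = "weighted_shift a j c \<theta>"
  have \<theta>0: "\<theta> \<in> test_fun_0 R" and T0: "?T \<in> test_fun_0 R"
    by (intro test_fun_infD(2) gaussian_deriv_test_fun_inf \<theta> c)+
  obtain B where B: "0 \<le> B" "\<And>s \<zeta>. \<bar>s\<bar> \<le> 1 \<Longrightarrow> cmod (?W s \<zeta> - \<theta> \<zeta> - s *\<^sub>R ?T \<zeta>) \<le> B * s\<^sup>2"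
    using weighted_shift_second_order[where a = a and j = j, OF \<theta> R a_pos c] by blast
  obtain B' where B': "\<And>s \<zeta>. \<bar>s\<bar> \<le> 1 \<Longrightarrow> cmod (?W s \<zeta>) \<le> B'"
    using weighted_shift_bound[where a = a and j = j, OF \<theta>0 R a_pos] by blast
  \<comment> \<open>For |s| at most 1 the shifted function may be nonzero up to radius
    \<open>R + cmod c\<close>, so f has to be bounded that far out.\<close>
  obtain M where M: "0 \<le> M" "\<And>\<zeta>. norm \<zeta> \<le> R + cmod c \<Longrightarrow> cmod (f (z - \<epsilon> *\<^sub>R \<zeta>)) \<le> M"
    using f_affine_bound by blast
  have main: "cmod (conv \<theta> (z + (\<epsilon> * s) *\<^sub>R single_coord j c) - conv \<theta> z - s *\<^sub>R conv ?T z)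
      \<le> M * (B * s\<^sup>2) * mass" if s: "\<bar>s\<bar> \<le> 1" for s
  proof -
    have intW: "integrable (P a) (\<lambda>\<zeta>. f (z - \<epsilon> *\<^sub>R \<zeta>) * ?W s \<zeta>)"
      by (rule integrable_product[OF continuous_on_weighted_shift[OF test_fun_0D(1)[OF \<theta>0]]
            weighted_shift_eq_0[OF \<theta>0 s] B'[OF s]])
    have "conv \<theta> (z + (\<epsilon> * s) *\<^sub>R single_coord j c) - conv \<theta> z - s *\<^sub>R conv ?T z =
        (\<integral>\<zeta>. f (z - \<epsilon> *\<^sub>R \<zeta>) * ?W s \<zeta> - f (z - \<epsilon> *\<^sub>R \<zeta>) * \<theta> \<zeta> - s *\<^sub>R (f (z - \<epsilon> *\<^sub>R \<zeta>) * ?T \<zeta>) \<partial>P a)"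
      unfolding conv_shift[OF \<theta>0]
      by (simp add: conv_def intW integrable_conv[OF \<theta>0] integrable_conv[OF T0])
    also have "\<dots> = (\<integral>\<zeta>. f (z - \<epsilon> *\<^sub>R \<zeta>) * (?W s \<zeta> - \<theta> \<zeta> - s *\<^sub>R ?T \<zeta>) \<partial>P a)"
      by (simp add: right_diff_distrib)
    also have "cmod \<dots> \<le> M * (B * s\<^sup>2) * mass"
    proof (rule bounded_integral(2))
      show "continuous_on UNIV (\<lambda>\<zeta>. f (z - \<epsilon> *\<^sub>R \<zeta>) * (?W s \<zeta> - \<theta> \<zeta> - s *\<^sub>R ?T \<zeta>))"
        by (intro continuous_on_mult continuous_on_diff continuous_on_scaleR continuous_on_const
            continuous_on_f_affine continuous_on_weighted_shift test_fun_0D(1)[OF \<theta>0]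
            test_fun_0D(1)[OF T0])
      show "cmod (f (z - \<epsilon> *\<^sub>R \<zeta>) * (?W s \<zeta> - \<theta> \<zeta> - s *\<^sub>R ?T \<zeta>)) \<le> M * (B * s\<^sup>2)" for \<zeta>
      proof (rule product_bound[where R = "R + cmod c", OF _ M(2) B(2)[OF s] M(1)])
        fix \<zeta> :: ell2 assume \<zeta>: "R + cmod c < norm \<zeta>"
        then have "R < norm \<zeta>"
          using norm_ge_zero[of c] by linarith
        then show "?W s \<zeta> - \<theta> \<zeta> - s *\<^sub>R ?T \<zeta> = 0"
          using weighted_shift_eq_0[OF \<theta>0 s \<zeta>] test_fun_0D(2)[OF \<theta>0] test_fun_0D(2)[OF T0] by simp
      qed
    qed
    finally show ?thesis .
  qed
  show ?thesis
  proof (rule has_vector_derivative_quadratic[OF eps_pos, where B = "M * B * mass / \<epsilon>\<^sup>2"])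
    fix t :: real assume t: "\<bar>t\<bar> \<le> \<epsilon>"
    \<comment> \<open>The substitution s = t / \<epsilon> produces the factor 1 / \<epsilon> in the
      derivative and the square of \<epsilon> in the remainder constant.\<close>
    then have "\<bar>t / \<epsilon>\<bar> \<le> 1"
      using eps_pos by simp
    from main[OF this]
    have "cmod (conv \<theta> (z + (\<epsilon> * (t / \<epsilon>)) *\<^sub>R single_coord j c) - conv \<theta> z - (t / \<epsilon>) *\<^sub>R conv ?T z)
        \<le> M * (B * (t / \<epsilon>)\<^sup>2) * mass" .
    moreover have "\<epsilon> * (t / \<epsilon>) = t"
      using eps_pos by simp
    moreover have "M * (B * (t / \<epsilon>)\<^sup>2) * mass = M * B * mass / \<epsilon>\<^sup>2 * t\<^sup>2"
      by (simp add: power_divide)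
    moreover have "(t / \<epsilon>) *\<^sub>R conv ?T z = t *\<^sub>R (of_real (1 / \<epsilon>) * conv ?T z)"
      by (simp add: scaleR_conv_of_real)
    ultimately show "cmod (conv \<theta> (z + t *\<^sub>R single_coord j c)
        - conv \<theta> (z + 0 *\<^sub>R single_coord j c) - t *\<^sub>R (of_real (1 / \<epsilon>) * conv ?T z))
        \<le> M * B * mass / \<epsilon>\<^sup>2 * t\<^sup>2"
      by (simp only: scaleR_zero_left add_0_right)
  qed
qed

definition conv_range :: "(ell2 \<Rightarrow> complex) set" where
  "conv_range = {conv \<theta> | \<theta> R. 0 \<le> R \<and> \<theta> \<in> test_fun_inf R}"

lemma conv_partial:
  assumes \<theta>: "\<theta> \<in> test_fun_inf R" and R: "0 \<le> R" and v: "v \<in> coord_dirs"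
  shows "has_partials v (conv \<theta>)" and "\<exists>\<eta>\<in>test_fun_inf R. partial v (conv \<theta>) = conv \<eta>"
proof -
  obtain j c where vc: "v = single_coord j c"
    using v by (auto simp: coord_dirs_def)
  let ?T = "gaussian_deriv a j c \<theta>"
  have c: "single_coord j c \<in> coord_dirs"
    using v vc by simp
  have T: "?T \<in> test_fun_inf R"
    by (rule gaussian_deriv_test_fun_inf[OF \<theta> c])
  note p = partialsI[of "conv \<theta>", OF conv_has_vector_derivative[OF \<theta> R c]]
  show "has_partials v (conv \<theta>)"
    unfolding vc by (rule p(1))
  \<comment> \<open>The scalar 1 / \<epsilon> is absorbed into the test function; the second summand
    is a dummy that fits the two-term linearity rule.\<close>
  have "partial v (conv \<theta>) = conv (\<lambda>\<zeta>. of_real (1 / \<epsilon>) * ?T \<zeta> + 0 * ?T \<zeta>)"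
    unfolding vc p(2) conv_lincomb[OF test_fun_infD(2)[OF T] test_fun_infD(2)[OF T]] by simp
  then show "\<exists>\<eta>\<in>test_fun_inf R. partial v (conv \<theta>) = conv \<eta>"
    using test_fun_inf_lincomb[OF T T] by blast
qed

lemma wirt_conv_range:
  assumes "F \<in> conv_range"
  shows "wirt s j F \<in> conv_range"
proof -
  obtain \<theta> R where \<theta>: "F = conv \<theta>" "0 \<le> R" "\<theta> \<in> test_fun_inf R"
    using assms by (auto simp: conv_range_def)
  obtain \<eta> where \<eta>: "\<eta> \<in> test_fun_inf R" "partial (x_dir j) F = conv \<eta>"
    using conv_partial(2)[OF \<theta>(3,2), of "x_dir j"] \<theta>(1) by auto
  obtain \<eta>' where \<eta>': "\<eta>' \<in> test_fun_inf R" "partial (y_dir j) F = conv \<eta>'"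
    using conv_partial(2)[OF \<theta>(3,2), of "y_dir j"] \<theta>(1) by auto
  have "wirt s j F = conv (\<lambda>\<zeta>. 1 / 2 * \<eta> \<zeta> + s / 2 * \<eta>' \<zeta>)"
    unfolding conv_lincomb[OF test_fun_infD(2)[OF \<eta>(1)] test_fun_infD(2)[OF \<eta>'(1)]] wirt_def \<eta>(2) \<eta>'(2) ..
  then show ?thesis
    unfolding conv_range_def using test_fun_inf_lincomb[OF \<eta>(1) \<eta>'(1)] \<theta>(2) by blast
qed

lemma conv_Ck:
  "\<theta> \<in> test_fun_inf R \<Longrightarrow> 0 \<le> R \<Longrightarrow> conv \<theta> \<in> Ck_ell2 k"
proof (induction k arbitrary: \<theta>)
  case 0
  then show ?case
    using continuous_on_Lip_ell2[OF conv_Lip[OF test_fun_infD(2)]] by simp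
next
  case (Suc k)
  have "has_partials v (conv \<theta>) \<and> partial v (conv \<theta>) \<in> Ck_ell2 k" if "v \<in> coord_dirs" for v
    using conv_partial[OF Suc.prems that] Suc.IH[OF _ Suc.prems(2)] by auto
  then show ?case
    using continuous_on_Lip_ell2[OF conv_Lip[OF test_fun_infD(2)[OF Suc.prems(1)] Suc.prems(2)]]
    unfolding Ck_ell2_Suc_iff by blast
qed

lemma conv_CinfFinf:
  assumes "\<theta> \<in> test_fun_inf R" "0 \<le> R"
  shows "conv \<theta> \<in> CinfFinf_ell2"
proof -
  have "conv \<theta> \<in> conv_range"
    using assms by (auto simp: conv_range_def)
  then have "iter_op del \<alpha> (iter_op delbar \<beta> (conv \<theta>)) \<in> conv_range" for \<alpha> \<beta>
    unfolding del_eq_wirt delbar_eq_wirt by (intro iter_op_induct wirt_conv_range)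
  moreover have "F \<in> C1F_ell2" if "F \<in> conv_range" for F
    using that C1F_ell2I conv_Ck conv_Lip test_fun_infD(2) unfolding conv_range_def by blast
  ultimately show ?thesis
    using conv_Ck[OF assms] by (auto simp: CinfFinf_ell2_def Cinf_ell2_def)
qed

text \<open>The normalisation of \<theta> brings \<open>f z\<close> under the integral, where
  arguments differ by at most \<epsilon> R. The bound \<epsilon> \<le> 1 keeps them in one ball, so
  \<open>C\<close> and \<open>B\<close> do not depend on \<epsilon> and the error is linear in
  it.\<close>

lemma conv_approx:
  assumes \<theta>: "\<theta> \<in> test_fun_0 R" and one: "(\<integral>\<zeta>. \<theta> \<zeta> \<partial>P a) = 1"
    and C: "0 < C" "C-lipschitz_on (cball 0 (norm z + R)) f" and B: "\<And>\<zeta>. cmod (\<theta> \<zeta>) \<le> B"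
    and "0 \<le> R" "\<epsilon> \<le> 1"
  shows "cmod (conv \<theta> z - f z) \<le> C * (\<epsilon> * R) * B * mass"
proof -
  have "integrable (P a) \<theta>"
    by (rule bounded_integral(1)[OF test_fun_0D(1)[OF \<theta>] B])
  then have "conv \<theta> z - f z = (\<integral>\<zeta>. f (z - \<epsilon> *\<^sub>R \<zeta>) * \<theta> \<zeta> - f z * \<theta> \<zeta> \<partial>P a)"
    by (simp add: conv_def integrable_conv[OF \<theta>] one)
  also have "\<dots> = (\<integral>\<zeta>. (f (z - \<epsilon> *\<^sub>R \<zeta>) - f z) * \<theta> \<zeta> \<partial>P a)"
    by (simp only: left_diff_distrib)
  also have "cmod \<dots> \<le> C * (\<epsilon> * R) * B * mass"
  proof (rule bounded_integral(2))
    show "continuous_on UNIV (\<lambda>\<zeta>. (f (z - \<epsilon> *\<^sub>R \<zeta>) - f z) * \<theta> \<zeta>)"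
      by (intro continuous_on_mult continuous_on_diff continuous_on_const continuous_on_f_affine
          test_fun_0D[OF \<theta>])
    show "cmod ((f (z - \<epsilon> *\<^sub>R \<zeta>) - f z) * \<theta> \<zeta>) \<le> C * (\<epsilon> * R) * B" for \<zeta>
    proof (rule product_bound[OF test_fun_0D(2)[OF \<theta>] _ B])
      fix \<zeta> :: ell2 assume \<zeta>: "norm \<zeta> \<le> R"
      have "norm (z - \<epsilon> *\<^sub>R \<zeta>) \<le> norm z + \<epsilon> * R"
        by (rule norm_affine_le[OF order_refl \<zeta>])
      also have "\<dots> \<le> norm z + R"
        using \<open>0 \<le> R\<close> \<open>\<epsilon> \<le> 1\<close> by (simp add: mult_left_le_one_le eps_pos less_imp_le)
      finally have "cmod (f (z - \<epsilon> *\<^sub>R \<zeta>) - f z) \<le> C * norm (\<epsilon> *\<^sub>R \<zeta>)"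
        using lipschitz_onD[OF C(2), of "z - \<epsilon> *\<^sub>R \<zeta>" z] \<open>0 \<le> R\<close>
        unfolding mem_cball_0 by (simp add: dist_norm)
      also have "\<dots> \<le> C * (\<epsilon> * R)"
        using \<zeta> eps_pos C(1) by simp
      finally show "cmod (f (z - \<epsilon> *\<^sub>R \<zeta>) - f z) \<le> C * (\<epsilon> * R)" .
    qed (use C \<open>0 \<le> R\<close> eps_pos in auto)
  qed
  finally show ?thesis .
qed

end

theorem theorem3p1:
  fixes a :: "nat \<Rightarrow> real" and \<theta> f :: "ell2 \<Rightarrow> complex"
    and f_eps :: "real \<Rightarrow> ell2 \<Rightarrow> complex"
  assumes "\<And>i. 0 < a i" and "summable a" and "(\<Sum>i. a i) < 1"
    and "\<theta> \<in> Cinf0_ell2" and "f \<in> Lip_ell2"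
    and "\<And>\<epsilon> z. 0 < \<epsilon> \<Longrightarrow> f_eps \<epsilon> z = (\<integral>\<zeta>. f (z - \<epsilon> *\<^sub>R \<zeta>) * \<theta> \<zeta> \<partial>P a)"
  shows "(\<forall>\<epsilon>>0. f_eps \<epsilon> \<in> CinfFinf_ell2) \<and>
    ((\<integral>\<zeta>. \<theta> \<zeta> \<partial>P a) = 1 \<longrightarrow> (\<forall>z. ((\<lambda>\<epsilon>. f_eps \<epsilon> z) \<longlongrightarrow> f z) (at_right 0)))"
proof -
  obtain R where R: "0 \<le> R" "\<theta> \<in> test_fun_inf R"
    using Cinf0_ell2_subset_test_fun_inf[OF assms(4)] .
  note \<theta>0 = test_fun_infD(2)[OF R(2)]
  have m: "mollifier a f \<epsilon>" if "0 < \<epsilon>" for \<epsilon>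
    using that assms by unfold_locales
  have f_eps: "f_eps \<epsilon> = mollifier.conv a f \<epsilon> \<theta>" if "0 < \<epsilon>" for \<epsilon>
    using assms(6)[OF that] by (simp add: fun_eq_iff mollifier.conv_def[OF m[OF that]])
  show ?thesis
  proof (intro conjI allI impI)
    fix \<epsilon> :: real assume "0 < \<epsilon>"
    then show "f_eps \<epsilon> \<in> CinfFinf_ell2"
      unfolding f_eps[OF \<open>0 < \<epsilon>\<close>] by (rule mollifier.conv_CinfFinf[OF m R(2,1)])
  next
    fix z :: ell2 assume one: "(\<integral>\<zeta>. \<theta> \<zeta> \<partial>P a) = 1"
    obtain C where C: "0 < C" "C-lipschitz_on (cball 0 (norm z + R)) f"
      using Lip_ell2_bound[OF assms(5)] by blast
    obtain B where B: "\<And>\<zeta>. cmod (\<theta> \<zeta>) \<le> B"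
      using test_fun_0_bound[OF \<theta>0] by blast
    have "cmod (f_eps \<epsilon> z - f z) \<le> C * (\<epsilon> * R) * B * measure (P a) UNIV"
      if "0 < \<epsilon>" "\<epsilon> < 1" for \<epsilon>
      unfolding f_eps[OF that(1)]
      by (rule mollifier.conv_approx[OF m[OF that(1)] \<theta>0 one C B R(1) less_imp_le[OF that(2)]])
    then have "\<forall>\<^sub>F \<epsilon> in at_right 0. norm (f_eps \<epsilon> z - f z) \<le> C * (\<epsilon> * R) * B * measure (P a) UNIV"
      by (intro eventually_at_rightI[of 0 1]) auto
    moreover have "((\<lambda>\<epsilon>. C * (\<epsilon> * R) * B * measure (P a) UNIV) \<longlongrightarrow>
        C * (0 * R) * B * measure (P a) UNIV) (at_right 0)"
      by (intro tendsto_intros)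
    ultimately have "((\<lambda>\<epsilon>. f_eps \<epsilon> z - f z) \<longlongrightarrow> 0) (at_right 0)"
      using Lim_null_comparison by fastforce
    then show "((\<lambda>\<epsilon>. f_eps \<epsilon> z) \<longlongrightarrow> f z) (at_right 0)"
      by (rule LIM_zero_cancel)
  qed
qed

end
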